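(* Let $G$ be a Lie group of dimension $n$ with Lie algebra $\mathfrak{g}$ of left invariant vector fields, and let $g(t)$ be a smooth one-parameter family of left invariant Riemannian metrics on $G$, with $t$ in an open interval containing $0$. Let $\{E_i\}_{i=1}^n$ be a frame of $\mathfrak{g}$ orthonormal with respect to $g(0)$, and let $\{E_i(t)\}$ be a smooth one-parameter family of frames of $\mathfrak{g}$ with $g(t)(E_i(t),E_j(t))=\delta_{ij}$ for all $t$ and $E_i(0)=E_i$. Let $Q(t)=(Q^j_i(t))$ be the smooth curve in $GL(n)=GL(n,\mathbb{R})$ defined by $E_i(t)=\sum_j Q^j_i(t)E_j$, and let $(\widetilde Q^i_j(t))$ be the inverse matrix of $(Q^i_j(t))$. Then $g(t)$ is a solution of the Ricci flow equation $$\frac{\partial}{\partial t}g(t)=-2\,\mathrm{Ric}(g(t))$$ if and only if $Q(t)$ satisfies, for all $i,j$ and all $t$, $$\sum_s \widetilde Q^j_s(t)\,\dot Q^s_i(t)+\sum_s\widetilde Q^i_s(t)\,\dot Q^s_j(t)=2R_{ij}(t),$$ where $R_{ij}(t)$ are the coordinates of the Ricci tensor of $g(t)$ with respect to the frame $\{E_i(t)\}$, given by the formula in the context.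
   Context: In the matrices $(Q^i_j)$ and $(\widetilde Q^i_j)$ the upper index is the row index and the lower index is the column index; the dot denotes $d/dt$. Let $C^k_{ij}$ be the structure constants of the fixed frame, $[E_i,E_j]=\sum_k C^k_{ij}E_k$. The structure constants with respect to $\{E_i(t)\}$ are $$C^k_{ij}(t)=\sum_{s,m,l}Q^s_i(t)Q^m_j(t)C^l_{sm}\widetilde Q^k_l(t),$$ and the coordinates of the Ricci tensor of $g(t)$ with respect to $\{E_i(t)\}$ are $$R_{jk}(t)=\sum_{s,m}\Big(-\tfrac12 C^s_{mj}(t)C^m_{sk}(t)+\tfrac14 C^j_{ms}(t)C^k_{ms}(t)-\tfrac12 C^s_{mj}(t)C^s_{mk}(t)+\tfrac12 C^m_{ms}(t)\big[C^k_{sj}(t)+C^j_{sk}(t)\big]\Big).$$ Here the sign convention for the Ricci tensor is the one for which round spheres have positive Ricci tensor. *)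

theory Defs
  imports "HOL-Analysis.Analysis"
begin

subsection \<open>Smooth maps between open subsets of Euclidean spaces\<close>

(* Only meaningful for open S, which is how it is used throughout. *)
primrec Ck_on ::
  "nat \<Rightarrow> 'a::euclidean_space set \<Rightarrow> ('a \<Rightarrow> 'b::real_normed_vector) \<Rightarrow> bool" where
  "Ck_on 0 S f \<longleftrightarrow> continuous_on S f"
| "Ck_on (Suc k) S f \<longleftrightarrow>
     (\<forall>x\<in>S. f differentiable (at x)) \<and>
     (\<forall>v. Ck_on k S (\<lambda>x. frechet_derivative f (at x) v))"

definition smooth_on ::
  "'a::euclidean_space set \<Rightarrow> ('a \<Rightarrow> 'b::real_normed_vector) \<Rightarrow> bool" where
  "smooth_on S f \<longleftrightarrow> (\<forall>k. Ck_on k S f)"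


subsection \<open>Smooth manifolds and Lie groups\<close>

(* A chart is its domain together with its coordinate map. *)
type_synonym ('a, 'e) chart = "'a set \<times> ('a \<Rightarrow> 'e)"

definition chart_inv :: "('a, 'e) chart \<Rightarrow> 'e \<Rightarrow> 'a" where
  "chart_inv c = inv_into (fst c) (snd c)"

definition smooth_atlas ::
  "('a::topological_space, 'e::euclidean_space) chart set \<Rightarrow> bool" where
  "smooth_atlas A \<longleftrightarrow>
     (\<Union>c\<in>A. fst c) = UNIV \<and>
     (\<forall>c\<in>A. open (fst c) \<and> open (snd c ` fst c) \<and>
        homeomorphism (fst c) (snd c ` fst c) (snd c) (chart_inv c)) \<and>
     (\<forall>c\<in>A. \<forall>d\<in>A. smooth_on (snd c ` (fst c \<inter> fst d)) (snd d \<circ> chart_inv c))"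

definition prod_atlas ::
  "('a, 'e) chart set \<Rightarrow> ('b, 'f) chart set \<Rightarrow> ('a \<times> 'b, 'e \<times> 'f) chart set" where
  "prod_atlas A B = (\<lambda>(c, d). (fst c \<times> fst d, map_prod (snd c) (snd d))) ` (A \<times> B)"

definition smooth_map ::
  "('a::topological_space, 'e::euclidean_space) chart set \<Rightarrow>
   ('b::topological_space, 'f::euclidean_space) chart set \<Rightarrow> ('a \<Rightarrow> 'b) \<Rightarrow> bool" where
  "smooth_map A B f \<longleftrightarrow>
     continuous_on UNIV f \<and>
     (\<forall>c\<in>A. \<forall>d\<in>B. smooth_on (snd c ` (fst c \<inter> f -` fst d)) (snd d \<circ> f \<circ> chart_inv c))"

definition lie_group ::
  "('a::{t2_space, second_countable_topology}, 'e::euclidean_space) chart set \<Rightarrow>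
   ('a \<Rightarrow> 'a \<Rightarrow> 'a) \<Rightarrow> 'a \<Rightarrow> ('a \<Rightarrow> 'a) \<Rightarrow> bool" where
  "lie_group A mul e inversion \<longleftrightarrow>
     smooth_atlas A \<and> group mul e inversion \<and>
     smooth_map (prod_atlas A A) A (\<lambda>(x, y). mul x y) \<and> smooth_map A A inversion"


subsection \<open>Tensor fields\<close>

(* Tensor fields are given by their components: for a field T, the value "T c p" holds the
   components of T at the point p with respect to the coordinate frame of the chart c. *)
type_synonym ('a, 'n) vfield = "('a, real ^ 'n) chart \<Rightarrow> 'a \<Rightarrow> real ^ 'n"
type_synonym ('a, 'n) tensor2 = "('a, real ^ 'n) chart \<Rightarrow> 'a \<Rightarrow> real ^ 'n ^ 'n"

definition smooth_field ::
  "('a, real ^ 'n) chart set \<Rightarrow>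
   (('a, real ^ 'n) chart \<Rightarrow> 'a \<Rightarrow> 'v::real_normed_vector) \<Rightarrow> bool" where
  "smooth_field A T \<longleftrightarrow> (\<forall>c\<in>A. smooth_on (snd c ` fst c) (\<lambda>u. T c (chart_inv c u)))"

(* Joint smoothness in the parameter and the point. *)
definition smooth_family ::
  "('a, real ^ 'n) chart set \<Rightarrow> real set \<Rightarrow>
   (real \<Rightarrow> ('a, real ^ 'n) chart \<Rightarrow> 'a \<Rightarrow> 'v::real_normed_vector) \<Rightarrow> bool" where
  "smooth_family A I T \<longleftrightarrow>
     (\<forall>c\<in>A. smooth_on (I \<times> snd c ` fst c) (\<lambda>(t, u). T t c (chart_inv c u)))"

(* The differential of f at p, in the coordinates c at p and d at f p. *)
definition tangent_map ::
  "('a, real ^ 'n) chart \<Rightarrow> ('a, real ^ 'n) chart \<Rightarrow> ('a \<Rightarrow> 'a) \<Rightarrow> 'a \<Rightarrow>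
   real ^ 'n \<Rightarrow> real ^ 'n" where
  "tangent_map c d f p = frechet_derivative (snd d \<circ> f \<circ> chart_inv c) (at (snd c p))"

(* df(X_p) = X_(f p) for all p; for f = id this is the transformation law of the components
   of X under change of charts. *)
definition vfield_invariant ::
  "('a, real ^ 'n) chart set \<Rightarrow> ('a \<Rightarrow> 'a) \<Rightarrow> ('a, 'n) vfield \<Rightarrow> bool" where
  "vfield_invariant A f X \<longleftrightarrow>
     (\<forall>c\<in>A. \<forall>d\<in>A. \<forall>p\<in>fst c. f p \<in> fst d \<longrightarrow>
        X d (f p) = tangent_map c d f p (X c p))"

(* f^* g = g; for f = id this is the transformation law of the components of g. *)
definition metric_invariant ::
  "('a, real ^ 'n) chart set \<Rightarrow> ('a \<Rightarrow> 'a) \<Rightarrow> ('a, 'n) tensor2 \<Rightarrow> bool" where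
  "metric_invariant A f g \<longleftrightarrow>
     (\<forall>c\<in>A. \<forall>d\<in>A. \<forall>p\<in>fst c. f p \<in> fst d \<longrightarrow>
        (\<forall>v w. tangent_map c d f p v \<bullet> (g d (f p) *v tangent_map c d f p w) =
               v \<bullet> (g c p *v w)))"

(* The last clause fixes the irrelevant values of X, so that two vector fields are equal as
   functions iff they are equal as vector fields. *)
definition vector_field :: "('a, real ^ 'n) chart set \<Rightarrow> ('a, 'n) vfield \<Rightarrow> bool" where
  "vector_field A X \<longleftrightarrow>
     vfield_invariant A id X \<and> smooth_field A X \<and>
     (\<forall>c p. c \<notin> A \<or> p \<notin> fst c \<longrightarrow> X c p = 0)"

definition riemannian_metric :: "('a, real ^ 'n) chart set \<Rightarrow> ('a, 'n) tensor2 \<Rightarrow> bool" where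
  "riemannian_metric A g \<longleftrightarrow>
     metric_invariant A id g \<and> smooth_field A g \<and>
     (\<forall>c\<in>A. \<forall>p\<in>fst c. transpose (g c p) = g c p \<and> (\<forall>v. v \<noteq> 0 \<longrightarrow> v \<bullet> (g c p *v v) > 0))"

definition left_invariant_metric ::
  "('a, real ^ 'n) chart set \<Rightarrow> ('a \<Rightarrow> 'a \<Rightarrow> 'a) \<Rightarrow> ('a, 'n) tensor2 \<Rightarrow> bool" where
  "left_invariant_metric A mul g \<longleftrightarrow>
     riemannian_metric A g \<and> (\<forall>a. metric_invariant A (mul a) g)"


subsection \<open>The Lie algebra of left invariant vector fields\<close>

definition lie_algebra ::
  "('a, real ^ 'n) chart set \<Rightarrow> ('a \<Rightarrow> 'a \<Rightarrow> 'a) \<Rightarrow> ('a, 'n) vfield set" where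
  "lie_algebra A mul = {X. vector_field A X \<and> (\<forall>a. vfield_invariant A (mul a) X)}"

definition lie_bracket ::
  "('a, real ^ 'n) chart set \<Rightarrow> ('a, 'n) vfield \<Rightarrow> ('a, 'n) vfield \<Rightarrow> ('a, 'n) vfield" where
  "lie_bracket A X Y c p =
     (if c \<in> A \<and> p \<in> fst c then
        frechet_derivative (\<lambda>u. Y c (chart_inv c u)) (at (snd c p)) (X c p) -
        frechet_derivative (\<lambda>u. X c (chart_inv c u)) (at (snd c p)) (Y c p)
      else 0)"

definition lincomb :: "('n \<Rightarrow> real) \<Rightarrow> ('n::finite \<Rightarrow> ('a, 'n) vfield) \<Rightarrow> ('a, 'n) vfield" where
  "lincomb a E = (\<lambda>c p. \<Sum>k\<in>UNIV. a k *\<^sub>R E k c p)"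

(* A frame is a basis of the Lie algebra. *)
definition frame ::
  "('a, real ^ 'n) chart set \<Rightarrow> ('a \<Rightarrow> 'a \<Rightarrow> 'a) \<Rightarrow> ('n::finite \<Rightarrow> ('a, 'n) vfield) \<Rightarrow> bool" where
  "frame A mul E \<longleftrightarrow>
     (\<forall>i. E i \<in> lie_algebra A mul) \<and>
     (\<forall>a. lincomb a E = (\<lambda>c p. 0) \<longrightarrow> (\<forall>k. a k = 0)) \<and>
     (\<forall>X\<in>lie_algebra A mul. \<exists>a. X = lincomb a E)"

definition orthonormal ::
  "('a, real ^ 'n) chart set \<Rightarrow> ('a, 'n) tensor2 \<Rightarrow> ('n::finite \<Rightarrow> ('a, 'n) vfield) \<Rightarrow> bool" where
  "orthonormal A g E \<longleftrightarrow>
     (\<forall>c\<in>A. \<forall>p\<in>fst c. \<forall>i j. E i c p \<bullet> (g c p *v E j c p) = (if i = j then 1 else 0))"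


subsection \<open>Ricci tensor and Ricci flow\<close>

definition pderiv_chart ::
  "('a, real ^ 'n) chart \<Rightarrow> 'n::finite \<Rightarrow> ('a \<Rightarrow> real) \<Rightarrow> 'a \<Rightarrow> real" where
  "pderiv_chart c i f p = frechet_derivative (f \<circ> chart_inv c) (at (snd c p)) (axis i 1)"

(* christoffel c g k i j p = Gamma^k_{ij}, the Levi-Civita connection of g in the chart c. *)
definition christoffel ::
  "('a, real ^ 'n) chart \<Rightarrow> ('a, 'n) tensor2 \<Rightarrow> 'n::finite \<Rightarrow> 'n \<Rightarrow> 'n \<Rightarrow> 'a \<Rightarrow> real" where
  "christoffel c g k i j p =
     (1/2) * (\<Sum>l\<in>UNIV. matrix_inv (g c p) $ k $ l *
       (pderiv_chart c i (\<lambda>q. g c q $ j $ l) p + pderiv_chart c j (\<lambda>q. g c q $ i $ l) p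
        - pderiv_chart c l (\<lambda>q. g c q $ i $ j) p))"

(* riemann c g l i j k p is the l-th component of R(d_i, d_j) d_k, where
   R(X, Y) Z = nabla_X nabla_Y Z - nabla_Y nabla_X Z - nabla_[X,Y] Z. *)
definition riemann ::
  "('a, real ^ 'n) chart \<Rightarrow> ('a, 'n) tensor2 \<Rightarrow> 'n::finite \<Rightarrow> 'n \<Rightarrow> 'n \<Rightarrow> 'n \<Rightarrow> 'a \<Rightarrow> real" where
  "riemann c g l i j k p =
     pderiv_chart c i (christoffel c g l j k) p - pderiv_chart c j (christoffel c g l i k) p
     + (\<Sum>m\<in>UNIV. christoffel c g l i m p * christoffel c g m j k p
                  - christoffel c g l j m p * christoffel c g m i k p)"

(* Ric(Y, Z) is the trace of X |-> R(X, Y) Z; it is positive on round spheres. *)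
definition ricci :: "('a, 'n) tensor2 \<Rightarrow> ('a, 'n::finite) tensor2" where
  "ricci g c p = (\<chi> j k. \<Sum>i\<in>UNIV. riemann c g i i j k p)"

definition ricci_flow ::
  "('a, real ^ 'n) chart set \<Rightarrow> real set \<Rightarrow> (real \<Rightarrow> ('a, 'n) tensor2) \<Rightarrow> bool" where
  "ricci_flow A I g \<longleftrightarrow>
     (\<forall>t\<in>I. \<forall>c\<in>A. \<forall>p\<in>fst c.
        ((\<lambda>s. g s c p) has_vector_derivative (-2) *\<^sub>R ricci (g t) c p) (at t))"


subsection \<open>Structure constants of a moving frame\<close>

(* Upper indices come first: C k i j = C^k_{ij} and Q $ j $ i = Q^j_i. *)
definition structure_constants ::
  "real ^ 'n ^ 'n \<Rightarrow> ('n \<Rightarrow> 'n \<Rightarrow> 'n \<Rightarrow> real) \<Rightarrow> 'n::finite \<Rightarrow> 'n \<Rightarrow> 'n \<Rightarrow> real" where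
  "structure_constants Q C k i j =
     (\<Sum>s\<in>UNIV. \<Sum>m\<in>UNIV. \<Sum>l\<in>UNIV.
        Q $ s $ i * Q $ m $ j * C l s m * matrix_inv Q $ k $ l)"

definition ricci_coord :: "('n \<Rightarrow> 'n \<Rightarrow> 'n \<Rightarrow> real) \<Rightarrow> 'n::finite \<Rightarrow> 'n \<Rightarrow> real" where
  "ricci_coord C j k =
     (\<Sum>s\<in>UNIV. \<Sum>m\<in>UNIV.
        - (1/2) * C s m j * C m s k + (1/4) * C j m s * C k m s
        - (1/2) * C s m j * C s m k + (1/2) * C m m s * (C k s j + C j s k))"

end

theory Submission
  imports Defs
begin

text \<open>
  In a chart, let the columns of \<open>F\<close> be the components of an orthonormal frame whose brackets have
  constant coefficients \<open>c\<close>, and let \<open>\<theta>\<close> be its inverse. With the constant matrices \<open>L\<^sub>i\<close> given by the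
  Koszul formula and \<open>\<Omega>\<^sub>a = \<Sum>\<^sub>i \<theta>\<^sup>i\<^sub>a L\<^sub>i\<close>, the matrices \<open>\<Gamma>\<^sub>a = (F \<Omega>\<^sub>a - \<partial>\<^sub>a F) \<theta>\<close> define a torsion free metric
  connection, so they are the Christoffel symbols. The curvature in the frame is then
  \<open>[L\<^sub>p, L\<^sub>q] - \<Sum>\<^sub>i c\<^sup>i\<^sub>p\<^sub>q L\<^sub>i\<close>, where equality of mixed partials of \<open>F\<close> and the Maurer-Cartan equation for
  \<open>\<theta>\<close> enter. Its Ricci contraction differs from the asserted formula by an antisymmetric
  term, which vanishes because the Ricci tensor is symmetric (first Bianchi identity).

  For the flow, differentiate \<open>(F\<^sub>0 Q)\<^sup>T g (F\<^sub>0 Q) = 1\<close> in \<open>t\<close>: in the moving frame \<open>\<partial>\<^sub>t g\<close> is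
  \<open>-(M + M\<^sup>T)\<close> with \<open>M = Q\<^sup>-\<^sup>1 Q'\<close>.
\<close>

subsection \<open>Partial derivatives\<close>

definition pd :: "'n::finite \<Rightarrow> (real ^ 'n \<Rightarrow> 'b::real_normed_vector) \<Rightarrow> real ^ 'n \<Rightarrow> 'b" where
  "pd a f u = frechet_derivative f (at u) (axis a 1)"

lemma pd_eqI:
  assumes "(f has_derivative f') (at u)"
  shows "pd a f u = f' (axis a 1)"
  using frechet_derivative_at[OF assms] by (simp add: pd_def)

lemma has_derivative_pd:
  "f differentiable (at u) \<Longrightarrow> (f has_derivative frechet_derivative f (at u)) (at u)"
  by (simp add: frechet_derivative_works)

text \<open>\<open>frechet_derivative\<close> is a choice among all derivatives at \<open>u\<close>,
  and functions equal near \<open>u\<close> have the same ones. The equality therefore holds also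
  where no derivative exists.\<close>

lemma pd_cong_open:
  assumes "open U" "u \<in> U" "\<And>v. v \<in> U \<Longrightarrow> f v = h v"
  shows "pd a f u = pd a h u"
proof -
  have "(f has_derivative D) (at u) \<longleftrightarrow> (h has_derivative D) (at u)" for D
    using has_derivative_transform_within_open[OF _ assms(1,2), of f D UNIV h]
      has_derivative_transform_within_open[OF _ assms(1,2), of h D UNIV f] assms(3) by auto
  then show ?thesis
    by (simp add: pd_def frechet_derivative_def)
qed

lemma differentiable_cong_open:
  assumes "open U" "u \<in> U" "\<And>v. v \<in> U \<Longrightarrow> f v = h v" "f differentiable (at u)"
  shows "h differentiable (at u)"
  using has_derivative_transform_within_open[OF _ assms(1,2), of f _ UNIV h] assms(3,4)
  unfolding differentiable_def by blast

lemma differentiable_bounded_linear: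
  assumes "bounded_linear h" "f differentiable (at u)"
  shows "(\<lambda>x. h (f x)) differentiable (at u)"
  using bounded_linear.has_derivative[OF assms(1)] assms(2) unfolding differentiable_def by blast

lemma pd_bounded_linear:
  assumes "bounded_linear h" "f differentiable (at u)"
  shows "pd a (\<lambda>x. h (f x)) u = h (pd a f u)"
  using pd_eqI[OF bounded_linear.has_derivative[OF assms(1) has_derivative_pd[OF assms(2)]]]
  by (simp add: pd_def)

lemma pd_diff:
  assumes "f differentiable (at u)" "h differentiable (at u)"
  shows "pd a (\<lambda>x. f x - h x) u = pd a f u - pd a h u"
  using pd_eqI[OF has_derivative_diff[OF assms[THEN has_derivative_pd]]] by (simp add: pd_def)

lemma pd_sum:
  assumes "\<And>i. i \<in> S \<Longrightarrow> f i differentiable (at u)"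
  shows "pd a (\<lambda>x. \<Sum>i\<in>S. f i x) u = (\<Sum>i\<in>S. pd a (f i) u)"
  using pd_eqI[OF has_derivative_sum[of S f, OF has_derivative_pd[OF assms]]] by (simp add: pd_def)

lemma pd_const: "pd a (\<lambda>x. k) u = 0"
  by (simp add: pd_def)

lemma bounded_bilinear_matrix_mult:
  "bounded_bilinear ((**) :: real ^ 'n ^ 'm \<Rightarrow> real ^ 'p ^ 'n \<Rightarrow> real ^ 'p ^ 'm)"
proof -
  have "bilinear ((**) :: real ^ 'n ^ 'm \<Rightarrow> real ^ 'p ^ 'n \<Rightarrow> real ^ 'p ^ 'm)"
    unfolding bilinear_def
    by (auto intro!: linearI simp: matrix_matrix_mult_def vec_eq_iff algebra_simps sum.distrib
        sum_distrib_left)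
  then show ?thesis
    by (simp add: bilinear_conv_bounded_bilinear)
qed

lemma bounded_linear_transpose: "bounded_linear (transpose :: real ^ 'n ^ 'm \<Rightarrow> real ^ 'm ^ 'n)"
  by (simp add: linear_conv_bounded_linear[symmetric] linear_iff transpose_def vec_eq_iff)

lemma bounded_linear_entry: "bounded_linear (\<lambda>M :: real ^ 'n ^ 'm. M $ i $ j)"
  by (simp add: linear_conv_bounded_linear[symmetric] linear_iff)

lemma differentiable_matrix_mult:
  fixes f :: "'a::real_normed_vector \<Rightarrow> real ^ 'n ^ 'm" and h :: "'a \<Rightarrow> real ^ 'p ^ 'n"
  assumes "f differentiable (at u)" "h differentiable (at u)"
  shows "(\<lambda>x. f x ** h x) differentiable (at u)"
  using bounded_bilinear.FDERIV[OF bounded_bilinear_matrix_mult] assms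
  unfolding differentiable_def by blast

lemma pd_matrix_mult:
  fixes f :: "real ^ 'k \<Rightarrow> real ^ 'n ^ 'm" and h :: "real ^ 'k \<Rightarrow> real ^ 'p ^ 'n"
  assumes "f differentiable (at u)" "h differentiable (at u)"
  shows "pd a (\<lambda>x. f x ** h x) u = f u ** pd a h u + pd a f u ** h u"
  using pd_eqI[OF bounded_bilinear.FDERIV[OF bounded_bilinear_matrix_mult
        assms[THEN has_derivative_pd]]]
  by (simp add: pd_def)

lemma differentiable_vec_lambda:
  fixes f :: "'i::finite \<Rightarrow> 'a::real_normed_vector \<Rightarrow> 'b::euclidean_space"
  assumes "\<And>i. f i differentiable (at u)"
  shows "(\<lambda>x. \<chi> i. f i x) differentiable (at u)"
proof -
  have bl: "bounded_linear (\<lambda>y::'b. axis i y :: 'b ^ 'i)" for i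
    by (simp add: linear_conv_bounded_linear[symmetric] linear_iff axis_def vec_eq_iff)
  have "(\<lambda>x. \<chi> i. f i x) = (\<lambda>x. \<Sum>i\<in>UNIV. axis i (f i x))"
    by (auto simp: vec_eq_iff axis_def fun_eq_iff if_distrib[of "\<lambda>z. _ z"] cong: if_cong)
  moreover have "(\<lambda>x. \<Sum>i\<in>UNIV. axis i (f i x)) differentiable (at u)"
    by (intro differentiable_sum ballI differentiable_bounded_linear[OF bl] assms) auto
  ultimately show ?thesis by simp
qed

subsection \<open>Symmetry of second derivatives\<close>

text \<open>Two applications of the mean value theorem: in direction \<open>v\<close> to the
  difference of \<open>f\<close> along two opposite sides of a parallelogram, then in direction
  \<open>w\<close> to \<open>D v f\<close>.\<close>

lemma second_difference_mvt:
  fixes f :: "'a::euclidean_space \<Rightarrow> real"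
  defines "D \<equiv> \<lambda>v h x. frechet_derivative h (at x) v"
  assumes h: "0 < h"
    and S: "\<And>s t. \<lbrakk>0 \<le> s; s \<le> h; 0 \<le> t; t \<le> h\<rbrakk> \<Longrightarrow> x + s *\<^sub>R v + t *\<^sub>R w \<in> S"
    and f: "\<And>y. y \<in> S \<Longrightarrow> f differentiable (at y)"
    and Dv: "\<And>y. y \<in> S \<Longrightarrow> D v f differentiable (at y)"
  obtains \<xi> \<eta> where "0 < \<xi>" "\<xi> < h" "0 < \<eta>" "\<eta> < h"
    "f (x + h *\<^sub>R v + h *\<^sub>R w) - f (x + h *\<^sub>R v) - f (x + h *\<^sub>R w) + f x =
     h * h * D w (D v f) (x + \<xi> *\<^sub>R v + \<eta> *\<^sub>R w)"
proof -
  have chain: "((\<lambda>s. k (y + s *\<^sub>R z)) has_real_derivative D z k (y + s *\<^sub>R z)) (at s)"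
    if k: "k differentiable (at (y + s *\<^sub>R z))" for k :: "'a \<Rightarrow> real" and y z s
  proof -
    have "((\<lambda>s. y + s *\<^sub>R z) has_derivative (\<lambda>r. r *\<^sub>R z)) (at s)"
      by (auto intro!: derivative_eq_intros)
    from has_derivative_compose[OF this] k
    have "((\<lambda>s. k (y + s *\<^sub>R z)) has_derivative
        (\<lambda>r. frechet_derivative k (at (y + s *\<^sub>R z)) (r *\<^sub>R z))) (at s)"
      by (simp add: frechet_derivative_works)
    moreover have "frechet_derivative k (at (y + s *\<^sub>R z)) (r *\<^sub>R z) = D z k (y + s *\<^sub>R z) * r" for r
      using linear_scale[OF linear_frechet_derivative[OF k]] by (simp add: D_def)
    ultimately show ?thesis
      by (simp add: has_field_derivative_def)
  qed
  \<comment> \<open>The increment of \<open>f\<close> in direction \<open>w\<close> as a function of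
    the position along \<open>v\<close>; its change from 0 to \<open>h\<close> is the mixed second
    difference.\<close>
  let ?\<psi> = "\<lambda>s. f (x + h *\<^sub>R w + s *\<^sub>R v) - f (x + s *\<^sub>R v)"
  have "\<exists>\<xi>. 0 < \<xi> \<and> \<xi> < h \<and> ?\<psi> h - ?\<psi> 0 =
      (h - 0) * (D v f (x + h *\<^sub>R w + \<xi> *\<^sub>R v) - D v f (x + \<xi> *\<^sub>R v))"
  proof (rule MVT2[OF h])
    fix s assume s: "0 \<le> s" "s \<le> h"
    have "x + h *\<^sub>R w + s *\<^sub>R v \<in> S" "x + s *\<^sub>R v \<in> S"
      using S[OF s, of h] S[OF s, of 0] h by (auto simp: algebra_simps)
    then show "(?\<psi> has_real_derivative D v f (x + h *\<^sub>R w + s *\<^sub>R v) - D v f (x + s *\<^sub>R v)) (at s)"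
      by (intro DERIV_diff chain f)
  qed
  then obtain \<xi> where \<xi>: "0 < \<xi>" "\<xi> < h"
    "?\<psi> h - ?\<psi> 0 = h * (D v f (x + h *\<^sub>R w + \<xi> *\<^sub>R v) - D v f (x + \<xi> *\<^sub>R v))" by auto
  have "\<exists>\<eta>. 0 < \<eta> \<and> \<eta> < h \<and>
      D v f (x + \<xi> *\<^sub>R v + h *\<^sub>R w) - D v f (x + \<xi> *\<^sub>R v + 0 *\<^sub>R w) =
      (h - 0) * D w (D v f) (x + \<xi> *\<^sub>R v + \<eta> *\<^sub>R w)"
    by (rule MVT2[OF h]) (use \<xi> in \<open>intro chain Dv S; simp\<close>)
  then obtain \<eta> where \<eta>: "0 < \<eta>" "\<eta> < h"
    "D v f (x + \<xi> *\<^sub>R v + h *\<^sub>R w) - D v f (x + \<xi> *\<^sub>R v) = h * D w (D v f) (x + \<xi> *\<^sub>R v + \<eta> *\<^sub>R w)"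
    by auto
  have "f (x + h *\<^sub>R v + h *\<^sub>R w) - f (x + h *\<^sub>R v) - f (x + h *\<^sub>R w) + f x = ?\<psi> h - ?\<psi> 0"
    by (simp add: algebra_simps)
  also have "\<dots> = h * h * D w (D v f) (x + \<xi> *\<^sub>R v + \<eta> *\<^sub>R w)"
    using \<xi>(3) \<eta>(3) by (simp add: add_ac mult.assoc)
  finally show ?thesis
    using that \<xi> \<eta> by blast
qed

text \<open>Schwarz's theorem. The mixed second difference is symmetric in \<open>v\<close> and
  \<open>w\<close>, so it is \<open>h * h\<close> times either mixed derivative, each at some point
  of the small parallelogram. Continuity at \<open>x\<close> then forces the two values at
  \<open>x\<close> to agree.\<close>

theorem second_derivative_commute:
  fixes f :: "'a::euclidean_space \<Rightarrow> real"
  defines "D \<equiv> \<lambda>v h x. frechet_derivative h (at x) v"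
  assumes S: "open S" "x \<in> S"
    and f: "\<And>y. y \<in> S \<Longrightarrow> f differentiable (at y)"
    and Dv: "\<And>y. y \<in> S \<Longrightarrow> D v f differentiable (at y)"
    and Dw: "\<And>y. y \<in> S \<Longrightarrow> D w f differentiable (at y)"
    and cont: "continuous_on S (D w (D v f))" "continuous_on S (D v (D w f))"
  shows "D w (D v f) x = D v (D w f) x"
proof (rule ccontr)
  assume ne: "D w (D v f) x \<noteq> D v (D w f) x"
  \<comment> \<open>Half the assumed gap: at suitable nearby points the two mixed derivatives
    coincide, while each is within \<open>e\<close> of its value at \<open>x\<close>.\<close>
  define e where "e = dist (D w (D v f) x) (D v (D w f) x) / 2"
  have e: "0 < e" using ne by (simp add: e_def)
  obtain r where r: "0 < r" "ball x r \<subseteq> S"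
    using S openE by blast
  have close: "\<exists>d>0. \<forall>y. dist y x < d \<longrightarrow> y \<in> S \<and> dist (k y) (k x) < e"
    if k: "continuous_on S k" for k :: "'a \<Rightarrow> real"
  proof -
    obtain d where "d > 0" "\<forall>y\<in>S. dist y x < d \<longrightarrow> dist (k y) (k x) < e"
      using k S(2) e unfolding continuous_on_iff by blast
    then show ?thesis
      using r by (intro exI[of _ "min d r"]) (auto simp: dist_commute subset_iff)
  qed
  obtain d1 where d1: "0 < d1"
    "\<And>y. dist y x < d1 \<Longrightarrow> y \<in> S \<and> dist (D w (D v f) y) (D w (D v f) x) < e"
    using close[OF cont(1)] by blast
  obtain d2 where d2: "0 < d2"
    "\<And>y. dist y x < d2 \<Longrightarrow> y \<in> S \<and> dist (D v (D w f) y) (D v (D w f) x) < e"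
    using close[OF cont(2)] by blast
  define d where "d = min d1 d2"
  \<comment> \<open>This keeps the whole parallelogram in the ball of radius \<open>d\<close>; the
    summand 1 covers the case that \<open>v\<close> and \<open>w\<close> both vanish.\<close>
  define h where "h = d / (2 * (norm v + norm w + 1))"
  have pos: "norm v + norm w + 1 > 0" by (simp add: add_nonneg_pos)
  have d: "0 < d" using d1 d2 by (simp add: d_def)
  have h: "0 < h" using d pos by (simp add: h_def)
  have hd: "h * (norm v + norm w) < d"
  proof -
    have "h * (norm v + norm w) < h * (2 * (norm v + norm w + 1))"
      using h by (intro mult_strict_left_mono) (auto simp: add_nonneg_pos)
    also have "\<dots> = d" using pos by (simp add: h_def)
    finally show ?thesis .
  qed
  have near: "dist (x + s *\<^sub>R v + t *\<^sub>R w) x < d" if "0 \<le> s" "s \<le> h" "0 \<le> t" "t \<le> h" for s t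
  proof -
    have "dist (x + s *\<^sub>R v + t *\<^sub>R w) x = norm (s *\<^sub>R v + t *\<^sub>R w)"
      by (simp add: dist_norm add.assoc)
    also have "\<dots> \<le> s * norm v + t * norm w"
      using norm_triangle_ineq[of "s *\<^sub>R v" "t *\<^sub>R w"] that by simp
    also have "\<dots> \<le> h * norm v + h * norm w"
      using that by (intro add_mono mult_right_mono) auto
    finally show ?thesis using hd by (simp add: algebra_simps)
  qed
  have inS: "x + s *\<^sub>R v + t *\<^sub>R w \<in> S" if "0 \<le> s" "s \<le> h" "0 \<le> t" "t \<le> h" for s t
    using near[OF that] d1 by (simp add: d_def)
  have inS': "x + s *\<^sub>R w + t *\<^sub>R v \<in> S" if "0 \<le> s" "s \<le> h" "0 \<le> t" "t \<le> h" for s t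
    using inS[OF that(3,4,1,2)] by (simp add: add_ac)
  obtain \<xi> \<eta> where 1: "0 < \<xi>" "\<xi> < h" "0 < \<eta>" "\<eta> < h"
    "f (x + h *\<^sub>R v + h *\<^sub>R w) - f (x + h *\<^sub>R v) - f (x + h *\<^sub>R w) + f x =
     h * h * D w (D v f) (x + \<xi> *\<^sub>R v + \<eta> *\<^sub>R w)"
    unfolding D_def by (rule second_difference_mvt[OF h inS f Dv[unfolded D_def]])
  obtain \<xi>' \<eta>' where 2: "0 < \<xi>'" "\<xi>' < h" "0 < \<eta>'" "\<eta>' < h"
    "f (x + h *\<^sub>R w + h *\<^sub>R v) - f (x + h *\<^sub>R w) - f (x + h *\<^sub>R v) + f x =
     h * h * D v (D w f) (x + \<xi>' *\<^sub>R w + \<eta>' *\<^sub>R v)"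
    unfolding D_def by (rule second_difference_mvt[OF h inS' f Dw[unfolded D_def]])
  have swap: "x + a *\<^sub>R w + b *\<^sub>R v = x + b *\<^sub>R v + a *\<^sub>R w" for a b
    by (simp add: add_ac)
  have "h * h * D w (D v f) (x + \<xi> *\<^sub>R v + \<eta> *\<^sub>R w) = h * h * D v (D w f) (x + \<eta>' *\<^sub>R v + \<xi>' *\<^sub>R w)"
    using 1(5) 2(5) unfolding swap by linarith
  then have "D w (D v f) (x + \<xi> *\<^sub>R v + \<eta> *\<^sub>R w) = D v (D w f) (x + \<eta>' *\<^sub>R v + \<xi>' *\<^sub>R w)"
    using h by simp
  moreover have "dist (D w (D v f) (x + \<xi> *\<^sub>R v + \<eta> *\<^sub>R w)) (D w (D v f) x) < e"
    using d1(2) near[of \<xi> \<eta>] 1 by (simp add: d_def)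
  moreover have "dist (D v (D w f) (x + \<eta>' *\<^sub>R v + \<xi>' *\<^sub>R w)) (D v (D w f) x) < e"
    using d2(2) near[of \<eta>' \<xi>'] 2 by (simp add: d_def)
  ultimately have "dist (D w (D v f) x) (D v (D w f) x) < e + e"
    using dist_triangle_less_add[of _ _ e _ e] by (metis dist_commute)
  then show False by (simp add: e_def)
qed

text \<open>Pairing with basis vectors commutes with differentiation and reduces the claim to
  real-valued functions.\<close>

lemma pd_pd_commute:
  fixes f :: "real ^ 'n::finite \<Rightarrow> 'b::euclidean_space"
  assumes S: "open S" "x \<in> S"
    and f: "\<And>y. y \<in> S \<Longrightarrow> f differentiable (at y)"
    and pd: "\<And>y a. y \<in> S \<Longrightarrow> pd a f differentiable (at y)"
    and cont: "\<And>a b. continuous_on S (pd a (pd b f))"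
  shows "pd a (pd b f) x = pd b (pd a f) x"
proof (rule euclidean_eqI)
  fix e :: 'b assume "e \<in> Basis"
  let ?f = "\<lambda>y. f y \<bullet> e"
  note bl = bounded_linear_inner_left
  have pd1: "pd a ?f y = pd a f y \<bullet> e" if "y \<in> S" for a y
    by (rule pd_bounded_linear[OF bl f[OF that]])
  have pd2: "pd a (pd b ?f) y = pd a (pd b f) y \<bullet> e" if "y \<in> S" for a b y
    using pd_cong_open[OF S(1) that, of "pd b ?f" "\<lambda>y. pd b f y \<bullet> e" a] pd1
      pd_bounded_linear[where a = a, OF bl pd[OF that, of b]] by simp
  have pd_eq: "pd a k = (\<lambda>x. frechet_derivative k (at x) (axis a 1))"
    for a and k :: "real ^ 'n \<Rightarrow> real"
    by (simp add: fun_eq_iff pd_def)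
  have f': "?f differentiable (at y)" if "y \<in> S" for y
    by (rule differentiable_bounded_linear[OF bl f[OF that]])
  have pd': "pd a ?f differentiable (at y)" if "y \<in> S" for a y
    using differentiable_cong_open[OF S(1) that, of "\<lambda>y. pd a f y \<bullet> e" "pd a ?f"] pd1
      differentiable_bounded_linear[OF bl pd[OF that]] by simp
  have cont': "continuous_on S (pd a (pd b ?f))" for a b
    using continuous_on_inner[OF cont[of a b] continuous_on_const[of S e]]
    by (rule continuous_on_eq) (simp add: pd2)
  have "pd a (pd b ?f) x = pd b (pd a ?f) x"
    using second_derivative_commute[OF S f' pd'[unfolded pd_eq] pd'[unfolded pd_eq]
        cont'[unfolded pd_eq] cont'[unfolded pd_eq]] by (simp add: pd_eq)
  then show "pd a (pd b f) x \<bullet> e = pd b (pd a f) x \<bullet> e"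
    using pd2[OF S(2)] by simp
qed

lemma frechet_derivative_eq_pd:
  fixes f :: "real ^ 'n::finite \<Rightarrow> 'b::real_normed_vector"
  assumes "f differentiable (at u)"
  shows "frechet_derivative f (at u) v = (\<Sum>a\<in>UNIV. v $ a *\<^sub>R pd a f u)"
proof -
  have lin: "linear (frechet_derivative f (at u))"
    by (rule linear_frechet_derivative[OF assms])
  have "frechet_derivative f (at u) (\<Sum>a\<in>UNIV. v $ a *\<^sub>R axis a 1) = (\<Sum>a\<in>UNIV. v $ a *\<^sub>R pd a f u)"
    by (simp add: linear_sum[OF lin] linear_scale[OF lin] pd_def)
  then show ?thesis
    using basis_expansion[of v] by (simp add: scalar_mult_eq_scaleR)
qed

subsection \<open>Frames with constant structure coefficients\<close>

lemmas matrix_distribs =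
  bounded_bilinear.add_left[OF bounded_bilinear_matrix_mult]
  bounded_bilinear.add_right[OF bounded_bilinear_matrix_mult]
  bounded_bilinear.diff_left[OF bounded_bilinear_matrix_mult]
  bounded_bilinear.diff_right[OF bounded_bilinear_matrix_mult]
  bounded_bilinear.minus_left[OF bounded_bilinear_matrix_mult]
  bounded_bilinear.minus_right[OF bounded_bilinear_matrix_mult]
  bounded_bilinear.scaleR_left[OF bounded_bilinear_matrix_mult]
  bounded_bilinear.scaleR_right[OF bounded_bilinear_matrix_mult]
  bounded_bilinear.sum_left[OF bounded_bilinear_matrix_mult]
  bounded_bilinear.sum_right[OF bounded_bilinear_matrix_mult]

lemmas transpose_distribs =
  linear_add[OF bounded_linear.linear[OF bounded_linear_transpose]]
  linear_diff[OF bounded_linear.linear[OF bounded_linear_transpose]]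
  linear_neg[OF bounded_linear.linear[OF bounded_linear_transpose]]

lemma matrix_mult_nth: "(M ** N) $ i $ j = (\<Sum>k\<in>UNIV. M $ i $ k * N $ k $ j)"
  by (simp add: matrix_matrix_mult_def)

lemma transpose_nth: "transpose M $ i $ j = M $ j $ i"
  by (simp add: transpose_def)

lemma matrix_inv_eqI:
  fixes M :: "real ^ 'n ^ 'n"
  assumes "N ** M = mat 1"
  shows "matrix_inv M = N"
proof -
  have MN: "M ** N = mat 1" using assms matrix_left_right_inverse by blast
  have "M ** matrix_inv M = mat 1 \<and> matrix_inv M ** M = mat 1"
    unfolding matrix_inv_def by (rule someI[of _ N]) (use assms MN in blast)
  then have "N ** (M ** matrix_inv M) = N" by simp
  then show ?thesis by (simp add: matrix_mul_assoc assms)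
qed

text \<open>A bilinear form is determined by its values on a frame. Identities checked in frame
  components are carried back to chart components in this way.\<close>

lemma matrix_congruence_cancel:
  fixes P :: "real ^ 'n ^ 'n"
  assumes "P ** R = mat 1" and "transpose P ** M ** P = transpose P ** N ** P"
  shows "M = N"
proof -
  have RP: "transpose R ** transpose P = mat 1"
    by (simp add: assms(1) matrix_transpose_mul[symmetric])
  have id: "transpose R ** (transpose P ** K ** P) ** R = K" for K :: "real ^ 'n ^ 'n"
  proof -
    have "transpose R ** (transpose P ** K ** P) ** R = (transpose R ** transpose P) ** K ** (P ** R)"
      by (simp only: matrix_mul_assoc)
    then show ?thesis by (simp add: RP assms(1))
  qed
  have "M = transpose R ** (transpose P ** M ** P) ** R"
    by (simp only: id)
  also have "\<dots> = N"
    by (simp only: assms(2) id)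
  finally show ?thesis .
qed

lemma transpose_mult_nth:
  "(transpose P ** M ** R) $ p $ q = (\<Sum>a\<in>UNIV. \<Sum>b\<in>UNIV. P $ a $ p * M $ a $ b * R $ b $ q)"
  for P :: "real ^ 'n ^ 'n"
  by (subst sum.swap) (simp add: matrix_mult_nth transpose_def sum_distrib_right)

text \<open>The situation inside one chart: column \<open>i\<close> of \<open>F u\<close> is the
  i-th frame field, \<open>G\<close> is the metric, and \<open>bracket\<close> is the coordinate
  form of the Lie bracket relation. Second-order smoothness of the frame enters as differentiability
  of \<open>pd a F\<close> and as \<open>pd_commute\<close>.\<close>

locale constant_frame =
  fixes U :: "(real ^ 'n::finite) set"
    and F G :: "real ^ 'n \<Rightarrow> real ^ 'n ^ 'n"
    and c :: "'n \<Rightarrow> 'n \<Rightarrow> 'n \<Rightarrow> real"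
  assumes open_U: "open U"
    and diff_F: "\<And>u. u \<in> U \<Longrightarrow> F differentiable (at u)"
    and diff_pd_F: "\<And>u a. u \<in> U \<Longrightarrow> pd a F differentiable (at u)"
    and pd_commute: "\<And>u a b. u \<in> U \<Longrightarrow> pd a (pd b F) u = pd b (pd a F) u"
    and diff_G: "\<And>u. u \<in> U \<Longrightarrow> G differentiable (at u)"
    and sym_G: "\<And>u. u \<in> U \<Longrightarrow> transpose (G u) = G u"
    and orthonormal_F: "\<And>u. u \<in> U \<Longrightarrow> transpose (F u) ** G u ** F u = mat 1"
    and skew_c: "\<And>k i j. c k i j = - c k j i"
    and bracket: "\<And>u k p q. u \<in> U \<Longrightarrow>
      (\<Sum>a\<in>UNIV. F u $ a $ p * pd a F u $ k $ q) - (\<Sum>a\<in>UNIV. F u $ a $ q * pd a F u $ k $ p) =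
      (\<Sum>m\<in>UNIV. c m p q * F u $ k $ m)"
begin

text \<open>\<open>L i $ m $ j\<close> is the \<open>m\<close>-th frame component of the covariant derivative of the \<open>j\<close>-th frame field
  along the \<open>i\<close>-th.\<close>

text \<open>\<open>L i $ m $ j\<close> is the \<open>m\<close>-th frame component of the covariant derivative of the \<open>j\<close>-th frame
  field along the \<open>i\<close>-th one.\<close>

definition L :: "'n \<Rightarrow> real ^ 'n ^ 'n" where
  "L i = (\<chi> m j. (c m i j - c i j m + c j m i) / 2)"

text \<open>The dual coframe, that is, the inverse of \<open>F\<close>. In this form its
  differentiability follows from that of \<open>F\<close> and \<open>G\<close>.\<close>

definition \<theta> :: "real ^ 'n \<Rightarrow> real ^ 'n ^ 'n" where
  "\<theta> u = transpose (F u) ** G u"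

definition \<Omega> :: "'n \<Rightarrow> real ^ 'n \<Rightarrow> real ^ 'n ^ 'n" where
  "\<Omega> a u = (\<Sum>i\<in>UNIV. \<theta> u $ i $ a *\<^sub>R L i)"

text \<open>Chosen so that \<open>pd a F + \<Gamma> a ** F = F ** \<Omega> a\<close>: the covariant
  derivatives of the frame fields have frame components \<open>\<Omega> a\<close>. It is the gauge
  transform of \<open>\<Omega>\<close> to the coordinate frame.\<close>

definition \<Gamma> :: "'n \<Rightarrow> real ^ 'n \<Rightarrow> real ^ 'n ^ 'n" where
  "\<Gamma> a u = (F u ** \<Omega> a u - pd a F u) ** \<theta> u"

section \<open>The Levi-Civita connection, in the frame and in the chart\<close>

lemma Koszul: "2 * L i $ m $ j = c m i j - c i j m + c j m i"
  by (simp add: L_def)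

text \<open>Metric compatibility: in an orthonormal frame the connection matrices are skew.\<close>

lemma transpose_L: "transpose (L i) = - L i"
proof -
  have "transpose (L i) $ j $ k = (- L i) $ j $ k" for j k
    using skew_c[of i j k] skew_c[of k i j] skew_c[of j i k] Koszul[of i k j] Koszul[of i j k]
    unfolding transpose_nth vector_uminus_component by linarith
  then show ?thesis
    by (simp add: vec_eq_iff)
qed

lemma L_torsion_free: "L p $ m $ q - L q $ m $ p = c m p q"
  using skew_c[of m q p] skew_c[of q m p] skew_c[of p m q] Koszul[of p m q] Koszul[of q m p]
  by linarith

lemma trace_L: "trace (L i) = 0"
proof -
  have "L i $ j $ j = 0" for j
    using skew_c[of j i j] skew_c[of i j j] Koszul[of i j j] by linarith
  then show ?thesis by (simp add: trace_def)
qed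

lemma \<theta>_F: "u \<in> U \<Longrightarrow> \<theta> u ** F u = mat 1"
  by (simp add: \<theta>_def orthonormal_F)

lemma F_\<theta>: "u \<in> U \<Longrightarrow> F u ** \<theta> u = mat 1"
  using \<theta>_F matrix_left_right_inverse by blast

lemma inv_G: "u \<in> U \<Longrightarrow> matrix_inv (G u) = F u ** transpose (F u)"
  using F_\<theta> by (intro matrix_inv_eqI) (simp add: \<theta>_def matrix_mul_assoc)

lemma \<theta>_F_sum: "u \<in> U \<Longrightarrow> (\<Sum>a\<in>UNIV. \<theta> u $ i $ a * F u $ a $ p) = (if i = p then 1 else 0)"
  using \<theta>_F[of u] by (simp add: vec_eq_iff matrix_mult_nth mat_def)

lemma diff_\<theta>: "u \<in> U \<Longrightarrow> \<theta> differentiable (at u)"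
  unfolding \<theta>_def[abs_def]
  by (intro differentiable_matrix_mult differentiable_bounded_linear[OF bounded_linear_transpose]
      diff_F diff_G)

lemma diff_\<Omega>: "u \<in> U \<Longrightarrow> \<Omega> a differentiable (at u)"
  unfolding \<Omega>_def[abs_def]
  by (intro differentiable_sum ballI differentiable_scaleR differentiable_const
      differentiable_bounded_linear[OF bounded_linear_entry] diff_\<theta>) auto

lemma diff_\<Gamma>: "u \<in> U \<Longrightarrow> \<Gamma> a differentiable (at u)"
  unfolding \<Gamma>_def[abs_def]
  by (intro differentiable_matrix_mult differentiable_diff diff_F diff_\<Omega> diff_pd_F diff_\<theta>)

lemma \<Gamma>_F: "u \<in> U \<Longrightarrow> \<Gamma> a u ** F u = F u ** \<Omega> a u - pd a F u"
  by (simp add: \<Gamma>_def matrix_mul_assoc[symmetric] \<theta>_F)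

lemma pd_F: "u \<in> U \<Longrightarrow> pd a F u = F u ** \<Omega> a u - \<Gamma> a u ** F u"
  by (simp add: \<Gamma>_F)

text \<open>\<open>\<theta>\<close> and \<open>F\<close> are dual, so evaluating the connection form
  on the p-th frame field leaves one matrix.\<close>

lemma contract_\<Omega>:
  assumes "u \<in> U"
  shows "(\<Sum>a\<in>UNIV. F u $ a $ p *\<^sub>R \<Omega> a u) = L p"
proof -
  have "(\<Sum>a\<in>UNIV. F u $ a $ p *\<^sub>R \<Omega> a u) =
      (\<Sum>i\<in>UNIV. (\<Sum>a\<in>UNIV. \<theta> u $ i $ a * F u $ a $ p) *\<^sub>R L i)"
    unfolding \<Omega>_def scaleR_sum_right scaleR_sum_left
    by (subst sum.swap) (simp add: mult.commute)
  also have "\<dots> = L p"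
    by (simp add: \<theta>_F_sum[OF assms] if_distrib[of "\<lambda>x. x *\<^sub>R _"] cong: if_cong)
  finally show ?thesis .
qed

text \<open>Vanishing torsion in the chart. Evaluated on two frame fields, the antisymmetric part is
  the difference supplied by \<open>L_torsion_free\<close> minus the bracket, and these
  cancel.\<close>

lemma \<Gamma>_symmetric:
  assumes u: "u \<in> U"
  shows "\<Gamma> a u $ k $ b = \<Gamma> b u $ k $ a"
proof -
  \<comment> \<open>With the upper index \<open>k\<close> fixed, the two lower indices form a
    bilinear form that can be tested on the frame.\<close>
  define N :: "real ^ 'n ^ 'n" where "N = (\<chi> a b. \<Gamma> a u $ k $ b)"
  have N: "(transpose (F u) ** N ** F u) $ p $ q =
      (F u ** L p) $ k $ q - (\<Sum>a\<in>UNIV. F u $ a $ p * pd a F u $ k $ q)" for p q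
  proof -
    have "(transpose (F u) ** N ** F u) $ p $ q =
        (\<Sum>a\<in>UNIV. F u $ a $ p * (\<Gamma> a u ** F u) $ k $ q)"
      unfolding transpose_mult_nth by (simp add: N_def matrix_mult_nth sum_distrib_left mult.assoc)
    also have "\<dots> = (\<Sum>a\<in>UNIV. F u $ a $ p * (F u ** \<Omega> a u) $ k $ q)
        - (\<Sum>a\<in>UNIV. F u $ a $ p * pd a F u $ k $ q)"
      by (simp add: \<Gamma>_F[OF u] algebra_simps sum_subtractf)
    also have "(\<Sum>a\<in>UNIV. F u $ a $ p * (F u ** \<Omega> a u) $ k $ q) =
        (F u ** (\<Sum>a\<in>UNIV. F u $ a $ p *\<^sub>R \<Omega> a u)) $ k $ q"
      by (simp add: matrix_distribs)
    finally show ?thesis by (simp add: contract_\<Omega>[OF u])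
  qed
  have "(transpose (F u) ** N ** F u) $ p $ q = (transpose (F u) ** N ** F u) $ q $ p" for p q
  proof -
    have "(F u ** L p) $ k $ q - (F u ** L q) $ k $ p = (\<Sum>m\<in>UNIV. c m p q * F u $ k $ m)"
      by (simp add: matrix_mult_nth sum_subtractf[symmetric] right_diff_distrib[symmetric]
          L_torsion_free mult.commute)
    then show ?thesis
      using bracket[OF u, of p k q] by (simp add: N)
  qed
  then have "transpose (transpose (F u) ** N ** F u) = transpose (F u) ** N ** F u"
    by (simp add: vec_eq_iff transpose_def)
  then have "transpose (F u) ** transpose N ** F u = transpose (F u) ** N ** F u"
    by (simp add: matrix_transpose_mul matrix_mul_assoc)
  then have "transpose N = N"
    by (rule matrix_congruence_cancel[OF F_\<theta>[OF u]])
  then show ?thesis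
    by (simp add: vec_eq_iff transpose_def N_def)
qed

text \<open>Differentiate the orthonormality relation and substitute \<open>pd_F\<close>. The
  contribution of \<open>\<Omega>\<close> cancels against its transpose because
  \<open>\<Omega>\<close> is skew, which leaves the contribution of \<open>\<Gamma>\<close>.\<close>

lemma \<Gamma>_metric:
  assumes u: "u \<in> U"
  shows "pd a G u = G u ** \<Gamma> a u + transpose (G u ** \<Gamma> a u)"
proof (rule matrix_congruence_cancel[OF F_\<theta>[OF u]])
  let ?T = "\<lambda>M. transpose M :: real ^ 'n ^ 'n"
  note d = diff_F[OF u] diff_G[OF u] differentiable_bounded_linear[OF bounded_linear_transpose diff_F[OF u]]
  have "pd a (\<lambda>v. ?T (F v) ** G v ** F v) u = pd a (\<lambda>v. mat 1) u"
    by (rule pd_cong_open[OF open_U u]) (rule orthonormal_F)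
  then have "?T (F u) ** G u ** pd a F u + (?T (F u) ** pd a G u + ?T (pd a F u) ** G u) ** F u = 0"
    by (simp add: pd_matrix_mult d differentiable_matrix_mult pd_const
        pd_bounded_linear[OF bounded_linear_transpose])
  moreover have "?T (pd a F u) ** G u ** F u = ?T (\<theta> u ** pd a F u)"
    by (simp add: \<theta>_def matrix_transpose_mul matrix_mul_assoc sym_G[OF u])
  ultimately have "\<theta> u ** pd a F u + (?T (F u) ** pd a G u ** F u + ?T (\<theta> u ** pd a F u)) = 0"
    by (simp add: \<theta>_def matrix_distribs)
  then have 1: "?T (F u) ** pd a G u ** F u =
      - (\<theta> u ** pd a F u) - ?T (\<theta> u ** pd a F u)"
    by (simp only: eq_diff_eq eq_neg_iff_add_eq_0 add_ac)
  have 2: "\<theta> u ** pd a F u = \<Omega> a u - ?T (F u) ** (G u ** \<Gamma> a u) ** F u"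
    using \<theta>_F[OF u]
    by (simp add: pd_F[OF u] matrix_distribs matrix_mul_assoc) (simp add: \<theta>_def matrix_mul_assoc)
  have 3: "?T (\<Omega> a u) = - \<Omega> a u"
    by (simp add: \<Omega>_def linear_sum[OF bounded_linear.linear[OF bounded_linear_transpose]]
        transpose_scalar transpose_L sum_negf)
  show "?T (F u) ** pd a G u ** F u =
      ?T (F u) ** (G u ** \<Gamma> a u + ?T (G u ** \<Gamma> a u)) ** F u"
    unfolding 1 2
    by (simp add: matrix_distribs transpose_distribs 3 matrix_transpose_mul matrix_mul_assoc)
qed

text \<open>Uniqueness of the Levi-Civita connection. By \<open>\<Gamma>_metric\<close> each
  derivative of the metric is a sum of two lowered symbols, and by their symmetry the alternating
  combination collapses to twice one of them.\<close>

lemma christoffel_eq_\<Gamma>: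
  assumes u: "u \<in> U"
  shows "(1/2) * (\<Sum>l\<in>UNIV. matrix_inv (G u) $ k $ l *
      (pd i (\<lambda>v. G v $ j $ l) u + pd j (\<lambda>v. G v $ i $ l) u - pd l (\<lambda>v. G v $ i $ j) u)) =
    \<Gamma> i u $ k $ j"
proof -
  \<comment> \<open>Symmetry of the Christoffel symbols of the first kind.\<close>
  have N: "(G u ** \<Gamma> x u) $ y $ z = (G u ** \<Gamma> z u) $ y $ x" for x y z
    by (simp add: matrix_mult_nth \<Gamma>_symmetric[OF u, of x _ z])
  have "pd x (\<lambda>v. G v $ y $ z) u = (G u ** \<Gamma> x u) $ y $ z + (G u ** \<Gamma> x u) $ z $ y" for x y z
    by (simp add: pd_bounded_linear[OF bounded_linear_entry diff_G[OF u]] \<Gamma>_metric[OF u] transpose_def)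
  then have "pd i (\<lambda>v. G v $ j $ l) u + pd j (\<lambda>v. G v $ i $ l) u - pd l (\<lambda>v. G v $ i $ j) u =
      2 * (G u ** \<Gamma> i u) $ l $ j" for l
    using N[of i j l] N[of j i l] N[of i l j] by simp
  then have "(1/2) * (\<Sum>l\<in>UNIV. matrix_inv (G u) $ k $ l *
      (pd i (\<lambda>v. G v $ j $ l) u + pd j (\<lambda>v. G v $ i $ l) u - pd l (\<lambda>v. G v $ i $ j) u)) =
      (matrix_inv (G u) ** (G u ** \<Gamma> i u)) $ k $ j"
    by (simp add: matrix_mult_nth[of "matrix_inv (G u)"] sum_distrib_left)
  also have "matrix_inv (G u) ** (G u ** \<Gamma> i u) = \<Gamma> i u"
    using F_\<theta>[OF u] by (simp add: inv_G[OF u] \<theta>_def matrix_mul_assoc)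
  finally show ?thesis .
qed

section \<open>Curvature in the chart and in the frame\<close>

definition curv :: "'n \<Rightarrow> 'n \<Rightarrow> real ^ 'n \<Rightarrow> real ^ 'n ^ 'n" where
  "curv a b u = pd a (\<Gamma> b) u - pd b (\<Gamma> a) u + (\<Gamma> a u ** \<Gamma> b u - \<Gamma> b u ** \<Gamma> a u)"

definition curv_frame :: "'n \<Rightarrow> 'n \<Rightarrow> real ^ 'n \<Rightarrow> real ^ 'n ^ 'n" where
  "curv_frame a b u = pd a (\<Omega> b) u - pd b (\<Omega> a) u + (\<Omega> a u ** \<Omega> b u - \<Omega> b u ** \<Omega> a u)"

text \<open>Gauge covariance of curvature. Differentiating \<open>\<Gamma>_F\<close> produces second
  derivatives of \<open>F\<close>, which drop out of the antisymmetrised expression by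
  \<open>pd_commute\<close>.\<close>

lemma curv_F:
  assumes u: "u \<in> U"
  shows "curv a b u ** F u = F u ** curv_frame a b u"
proof -
  have d: "pd a (\<Gamma> b) u ** F u = F u ** pd a (\<Omega> b) u + pd a F u ** \<Omega> b u - pd a (pd b F) u
      - \<Gamma> b u ** pd a F u" for a b
  proof -
    have "pd a (\<lambda>v. \<Gamma> b v ** F v) u = pd a (\<lambda>v. F v ** \<Omega> b v - pd b F v) u"
      by (rule pd_cong_open[OF open_U u]) (rule \<Gamma>_F)
    then show ?thesis
      by (simp add: pd_matrix_mult pd_diff diff_\<Gamma>[OF u] diff_F[OF u] diff_\<Omega>[OF u] diff_pd_F[OF u]
          differentiable_matrix_mult algebra_simps)
  qed
  have "curv a b u ** F u = pd a (\<Gamma> b) u ** F u - pd b (\<Gamma> a) u ** F u +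
      (\<Gamma> a u ** (\<Gamma> b u ** F u) - \<Gamma> b u ** (\<Gamma> a u ** F u))"
    by (simp add: curv_def matrix_distribs matrix_mul_assoc)
  also have "\<dots> = F u ** curv_frame a b u"
    unfolding d pd_commute[OF u, of b a] pd_F[OF u] curv_frame_def
    by (simp add: matrix_distribs matrix_mul_assoc)
  finally show ?thesis .
qed

text \<open>For frame fields X and Y the functions \<open>\<theta>\<close>(X) and
  \<open>\<theta>\<close>(Y) are constant, so the exterior derivative of \<open>\<theta>\<close> on
  X, Y is minus \<open>\<theta>\<close> of their bracket. This is verified on the frame and carried
  back by congruence.\<close>

lemma Maurer_Cartan:
  assumes u: "u \<in> U"
  shows "pd a \<theta> u $ i $ b - pd b \<theta> u $ i $ a =
    - (\<Sum>p\<in>UNIV. \<Sum>q\<in>UNIV. \<theta> u $ p $ a * c i p q * \<theta> u $ q $ b)"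
proof -
  define K :: "real ^ 'n ^ 'n" where "K = (\<chi> a b. pd a \<theta> u $ i $ b - pd b \<theta> u $ i $ a)"
  define M :: "real ^ 'n ^ 'n" where "M = (\<chi> a b. pd a \<theta> u $ i $ b)"
  define N :: "real ^ 'n ^ 'n" where "N = (\<chi> p q. - c i p q)"
  \<comment> \<open>Derivatives of the coframe are traded for derivatives of \<open>F\<close>, about
    which \<open>bracket\<close> speaks.\<close>
  have d: "pd a \<theta> u ** F u = - (\<theta> u ** pd a F u)" for a
  proof -
    have "pd a (\<lambda>v. \<theta> v ** F v) u = pd a (\<lambda>v. mat 1) u"
      by (rule pd_cong_open[OF open_U u]) (rule \<theta>_F)
    then have "\<theta> u ** pd a F u + pd a \<theta> u ** F u = 0"
      by (simp add: pd_matrix_mult diff_\<theta>[OF u] diff_F[OF u] pd_const)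
    then show ?thesis
      by (simp only: eq_neg_iff_add_eq_0 add.commute)
  qed
  have M: "(transpose (F u) ** M ** F u) $ p $ q =
      - (\<Sum>k\<in>UNIV. \<theta> u $ i $ k * (\<Sum>a\<in>UNIV. F u $ a $ p * pd a F u $ k $ q))" for p q
  proof -
    have "(transpose (F u) ** M ** F u) $ p $ q =
        (\<Sum>a\<in>UNIV. F u $ a $ p * (pd a \<theta> u ** F u) $ i $ q)"
      unfolding transpose_mult_nth by (simp add: M_def matrix_mult_nth sum_distrib_left mult.assoc)
    also have "\<dots> = - (\<Sum>a\<in>UNIV. \<Sum>k\<in>UNIV. \<theta> u $ i $ k * (F u $ a $ p * pd a F u $ k $ q))"
      by (simp add: d matrix_mult_nth sum_negf sum_distrib_left mult_ac)
    also have "\<dots> = - (\<Sum>k\<in>UNIV. \<theta> u $ i $ k * (\<Sum>a\<in>UNIV. F u $ a $ p * pd a F u $ k $ q))"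
      by (subst sum.swap) (simp add: sum_distrib_left)
    finally show ?thesis .
  qed
  have "(transpose (F u) ** K ** F u) $ p $ q = N $ p $ q" for p q
  proof -
    have "K = M - transpose M"
      by (simp add: K_def M_def transpose_def vec_eq_iff)
    then have "transpose (F u) ** K ** F u =
        transpose (F u) ** M ** F u - transpose (transpose (F u) ** M ** F u)"
      by (simp add: matrix_distribs matrix_transpose_mul matrix_mul_assoc)
    then have "(transpose (F u) ** K ** F u) $ p $ q =
        (transpose (F u) ** M ** F u) $ p $ q - (transpose (F u) ** M ** F u) $ q $ p"
      by (simp only: vector_minus_component transpose_nth)
    also have "\<dots> = - (\<Sum>k\<in>UNIV. \<theta> u $ i $ k * ((\<Sum>a\<in>UNIV. F u $ a $ p * pd a F u $ k $ q) -
            (\<Sum>a\<in>UNIV. F u $ a $ q * pd a F u $ k $ p)))"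
      by (simp add: M right_diff_distrib sum_subtractf)
    also have "\<dots> = - (\<Sum>k\<in>UNIV. \<Sum>m\<in>UNIV. c m p q * (\<theta> u $ i $ k * F u $ k $ m))"
      by (simp add: bracket[OF u] sum_distrib_left mult_ac)
    also have "\<dots> = - (\<Sum>m\<in>UNIV. c m p q * (\<Sum>k\<in>UNIV. \<theta> u $ i $ k * F u $ k $ m))"
      by (subst sum.swap) (simp add: sum_distrib_left)
    finally show ?thesis
      by (simp add: \<theta>_F_sum[OF u] N_def if_distrib[of "\<lambda>x. _ * x"] cong: if_cong)
  qed
  then have "transpose (F u) ** K ** F u = N"
    by (simp add: vec_eq_iff)
  \<comment> \<open>Both sides must be congruent by the same \<open>F\<close> before cancelling, so
    identities are inserted around \<open>N\<close>.\<close>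
  also have "N = (transpose (F u) ** transpose (\<theta> u)) ** N ** (\<theta> u ** F u)"
    by (simp add: matrix_transpose_mul[symmetric] \<theta>_F[OF u])
  also have "\<dots> = transpose (F u) ** (transpose (\<theta> u) ** N ** \<theta> u) ** F u"
    by (simp only: matrix_mul_assoc)
  finally have "K = transpose (\<theta> u) ** N ** \<theta> u"
    by (rule matrix_congruence_cancel[OF F_\<theta>[OF u]])
  then have "K $ a $ b = (transpose (\<theta> u) ** N ** \<theta> u) $ a $ b" by simp
  then show ?thesis
    unfolding transpose_mult_nth by (simp add: K_def N_def sum_negf)
qed

text \<open>The curvature endomorphism of two frame fields; the coefficients \<open>L\<close> are
  constant, so no derivative terms occur.\<close>

definition curv_coeff :: "'n \<Rightarrow> 'n \<Rightarrow> real ^ 'n ^ 'n" where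
  "curv_coeff p q = L p ** L q - L q ** L p - (\<Sum>i\<in>UNIV. c i p q *\<^sub>R L i)"

text \<open>Only \<open>\<theta>\<close> varies in \<open>\<Omega>\<close>. The derivative terms
  become the bracket term of \<open>curv_coeff\<close> by \<open>Maurer_Cartan\<close>; the
  quadratic terms become the commutator.\<close>

lemma curv_frame_eq:
  assumes u: "u \<in> U"
  shows "curv_frame a b u = (\<Sum>p\<in>UNIV. \<Sum>q\<in>UNIV. (\<theta> u $ p $ a * \<theta> u $ q $ b) *\<^sub>R curv_coeff p q)"
proof -
  have pd: "pd a (\<Omega> b) u = (\<Sum>i\<in>UNIV. pd a \<theta> u $ i $ b *\<^sub>R L i)" for a b
  proof -
    have bl: "bounded_linear (\<lambda>M :: real ^ 'n ^ 'n. M $ i $ b *\<^sub>R L i)" for i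
      by (intro bounded_linear_scaleR_const bounded_linear_entry)
    show ?thesis
      unfolding \<Omega>_def[abs_def]
      by (simp add: pd_sum differentiable_bounded_linear[OF bl diff_\<theta>[OF u]]
          pd_bounded_linear[OF bl diff_\<theta>[OF u]])
  qed
  have 1: "pd a (\<Omega> b) u - pd b (\<Omega> a) u =
      - (\<Sum>p\<in>UNIV. \<Sum>q\<in>UNIV. (\<theta> u $ p $ a * \<theta> u $ q $ b) *\<^sub>R (\<Sum>i\<in>UNIV. c i p q *\<^sub>R L i))"
  proof -
    have "pd a (\<Omega> b) u - pd b (\<Omega> a) u =
        (\<Sum>i\<in>UNIV. (pd a \<theta> u $ i $ b - pd b \<theta> u $ i $ a) *\<^sub>R L i)"
      by (simp add: pd sum_subtractf scaleR_left_diff_distrib)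
    also have "\<dots> = - (\<Sum>i\<in>UNIV. \<Sum>p\<in>UNIV. \<Sum>q\<in>UNIV. (\<theta> u $ p $ a * \<theta> u $ q $ b) *\<^sub>R (c i p q *\<^sub>R L i))"
      by (simp add: Maurer_Cartan[OF u] sum_negf scaleR_sum_left mult_ac)
    also have "\<dots> = - (\<Sum>p\<in>UNIV. \<Sum>i\<in>UNIV. \<Sum>q\<in>UNIV. (\<theta> u $ p $ a * \<theta> u $ q $ b) *\<^sub>R (c i p q *\<^sub>R L i))"
      by (subst sum.swap) simp
    also have "\<dots> = - (\<Sum>p\<in>UNIV. \<Sum>q\<in>UNIV. \<Sum>i\<in>UNIV. (\<theta> u $ p $ a * \<theta> u $ q $ b) *\<^sub>R (c i p q *\<^sub>R L i))"
      by (intro arg_cong[where f = uminus] sum.cong refl sum.swap)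
    finally show ?thesis by (simp add: scaleR_sum_right)
  qed
  have 2: "\<Omega> a u ** \<Omega> b u =
      (\<Sum>p\<in>UNIV. \<Sum>q\<in>UNIV. (\<theta> u $ p $ a * \<theta> u $ q $ b) *\<^sub>R (L p ** L q))" for a b
    by (simp add: \<Omega>_def matrix_distribs scaleR_sum_right)
      (subst sum.swap, simp add: mult.commute)
  \<comment> \<open>The summation indices are exchanged so that all terms carry the same
    coefficient.\<close>
  have 3: "\<Omega> b u ** \<Omega> a u =
      (\<Sum>p\<in>UNIV. \<Sum>q\<in>UNIV. (\<theta> u $ p $ a * \<theta> u $ q $ b) *\<^sub>R (L q ** L p))"
  proof -
    have "\<Omega> b u ** \<Omega> a u =
        (\<Sum>p\<in>UNIV. \<Sum>q\<in>UNIV. (\<theta> u $ q $ b * \<theta> u $ p $ a) *\<^sub>R (L q ** L p))"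
      unfolding 2[of b a] by (rule sum.swap)
    also have "\<dots> = (\<Sum>p\<in>UNIV. \<Sum>q\<in>UNIV. (\<theta> u $ p $ a * \<theta> u $ q $ b) *\<^sub>R (L q ** L p))"
      by (simp only: mult.commute)
    finally show ?thesis .
  qed
  show ?thesis
    unfolding curv_frame_def 1 2[of a b] 3 curv_coeff_def
    by (simp add: scaleR_right_diff_distrib sum_subtractf)
qed

text \<open>\<open>curv\<close> is conjugate to \<open>curv_frame\<close>, which is a combination of
  commutators and of the trace-free matrices \<open>L\<close>.\<close>

lemma trace_curv:
  assumes u: "u \<in> U"
  shows "trace (curv a b u) = 0"
proof -
  have tr1: "trace (x *\<^sub>R M) = x * trace M" for x and M :: "real ^ 'n ^ 'n"
    by (simp add: trace_def sum_distrib_left)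
  have tr2: "trace (sum K A) = (\<Sum>p\<in>A. trace (K p))" for K :: "'n \<Rightarrow> real ^ 'n ^ 'n" and A
    unfolding trace_def sum_component by (rule sum.swap)
  have "curv a b u = curv a b u ** F u ** \<theta> u"
    by (simp add: matrix_mul_assoc[symmetric] F_\<theta>[OF u])
  then have "curv a b u = F u ** curv_frame a b u ** \<theta> u"
    by (simp add: curv_F[OF u])
  then have "trace (curv a b u) = trace (\<theta> u ** (F u ** curv_frame a b u))"
    by (simp only: trace_mul_sym[of "F u ** curv_frame a b u"])
  also have "\<dots> = trace (curv_frame a b u)"
    by (simp add: matrix_mul_assoc \<theta>_F[OF u])
  also have "\<dots> = 0"
    by (simp add: curv_frame_eq[OF u] tr1 tr2 curv_coeff_def trace_sub trace_L trace_mul_sym[of "L _" "L _"])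
  finally show ?thesis .
qed

lemma curv_skew: "curv a b u = - curv b a u"
  by (simp add: curv_def)

text \<open>Symmetry of \<open>\<Gamma>\<close> in its lower indices makes the derivative terms and
  the quadratic terms cancel separately in the cyclic sum.\<close>

lemma Bianchi:
  assumes u: "u \<in> U"
  shows "curv i j u $ l $ k + curv j k u $ l $ i + curv k i u $ l $ j = 0"
proof -
  have pd: "pd x (\<Gamma> y) u $ l $ z = pd x (\<Gamma> z) u $ l $ y" for x y z
  proof -
    have "pd x (\<lambda>v. \<Gamma> y v $ l $ z) u = pd x (\<lambda>v. \<Gamma> z v $ l $ y) u"
      by (rule pd_cong_open[OF open_U u]) (rule \<Gamma>_symmetric)
    then show ?thesis
      by (simp add: pd_bounded_linear[OF bounded_linear_entry] diff_\<Gamma>[OF u])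
  qed
  have mult: "(\<Gamma> x u ** \<Gamma> y u) $ l $ z = (\<Gamma> x u ** \<Gamma> z u) $ l $ y" for x y z
    by (simp add: matrix_mult_nth \<Gamma>_symmetric[OF u, of y _ z])
  show ?thesis
    unfolding curv_def
    by (simp add: pd[of i j k] pd[of j k i] pd[of k i j] mult[of i j k] mult[of j k i] mult[of k i j])
qed

section \<open>The Ricci contraction, its symmetry and its formula in structure constants\<close>

definition ric :: "real ^ 'n \<Rightarrow> real ^ 'n ^ 'n" where
  "ric u = (\<chi> j k. \<Sum>i\<in>UNIV. curv i j u $ i $ k)"

definition frame_ricci :: "real ^ 'n ^ 'n" where
  "frame_ricci = (\<chi> q r. \<Sum>m\<in>UNIV. curv_coeff m q $ m $ r)"

text \<open>Contracting the Bianchi identity shows that the antisymmetric part of the Ricci tensor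
  is, up to sign, the trace of the curvature.\<close>

lemma transpose_ric:
  assumes u: "u \<in> U"
  shows "transpose (ric u) = ric u"
proof -
  have "ric u $ j $ k - ric u $ k $ j = 0" for j k
  proof -
    have "curv i j u $ i $ k - curv i k u $ i $ j = - curv j k u $ i $ i" for i
      using Bianchi[OF u, of i j i k] by (simp add: curv_skew[of i k])
    then have "ric u $ j $ k - ric u $ k $ j = - trace (curv j k u)"
      by (simp add: ric_def sum_subtractf[symmetric] sum_negf trace_def)
    then show ?thesis by (simp add: trace_curv[OF u])
  qed
  then show ?thesis by (simp add: vec_eq_iff transpose_def)
qed

lemma ric_frame:
  assumes u: "u \<in> U"
  shows "transpose (F u) ** ric u ** F u = frame_ricci"
proof -
  have "(ric u ** F u) $ j $ r = (transpose (\<theta> u) ** frame_ricci) $ j $ r" for j r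
  proof -
    have "(ric u ** F u) $ j $ r = (\<Sum>i\<in>UNIV. (curv i j u ** F u) $ i $ r)"
      by (simp add: ric_def matrix_mult_nth sum_distrib_right) (rule sum.swap)
    also have "\<dots> = (\<Sum>i\<in>UNIV. \<Sum>m\<in>UNIV. \<Sum>p\<in>UNIV. \<Sum>q\<in>UNIV.
        F u $ i $ m * (\<theta> u $ p $ i * \<theta> u $ q $ j * curv_coeff p q $ m $ r))"
      by (simp add: curv_F[OF u] matrix_mult_nth curv_frame_eq[OF u] sum_distrib_left)
    also have "\<dots> = (\<Sum>m\<in>UNIV. \<Sum>p\<in>UNIV. \<Sum>q\<in>UNIV. \<Sum>i\<in>UNIV.
        F u $ i $ m * (\<theta> u $ p $ i * \<theta> u $ q $ j * curv_coeff p q $ m $ r))"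
      \<comment> \<open>The sum over \<open>i\<close> is moved innermost, where duality of
        \<open>\<theta>\<close> and \<open>F\<close> evaluates it.\<close>
      by (subst sum.swap, rule sum.cong[OF refl], subst sum.swap, rule sum.cong[OF refl],
          subst sum.swap, rule refl)
    also have "\<dots> = (\<Sum>m\<in>UNIV. \<Sum>p\<in>UNIV. \<Sum>q\<in>UNIV.
        (\<Sum>i\<in>UNIV. \<theta> u $ p $ i * F u $ i $ m) * (\<theta> u $ q $ j * curv_coeff p q $ m $ r))"
      by (simp add: sum_distrib_right sum_distrib_left mult_ac)
    also have "\<dots> = (\<Sum>m\<in>UNIV. \<Sum>q\<in>UNIV. \<theta> u $ q $ j * curv_coeff m q $ m $ r)"
      by (rule sum.cong[OF refl], subst sum.swap)
        (simp add: \<theta>_F_sum[OF u] if_distrib[of "\<lambda>x. x * _"] cong: if_cong)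
    also have "\<dots> = (transpose (\<theta> u) ** frame_ricci) $ j $ r"
      by (subst sum.swap) (simp add: matrix_mult_nth transpose_def frame_ricci_def sum_distrib_left)
    finally show ?thesis .
  qed
  then have "ric u ** F u = transpose (\<theta> u) ** frame_ricci"
    by (simp add: vec_eq_iff)
  moreover have "transpose (F u) ** transpose (\<theta> u) = mat 1"
    by (simp add: matrix_transpose_mul[symmetric] \<theta>_F[OF u])
  ultimately show ?thesis
    by (simp add: matrix_mul_assoc[symmetric]) (simp add: matrix_mul_assoc)
qed

lemma transpose_frame_ricci:
  assumes "u \<in> U"
  shows "transpose frame_ricci = frame_ricci"
  using transpose_ric[OF assms]
  by (simp add: ric_frame[OF assms, symmetric] matrix_transpose_mul matrix_mul_assoc)

text \<open>By \<open>L_torsion_free\<close> the bracket term splits into two products of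
  \<open>L\<close>; one of them cancels half of the commutator after renaming summation
  indices.\<close>

lemma frame_ricci_eq:
  "frame_ricci $ q $ r = (\<Sum>s\<in>UNIV. \<Sum>m\<in>UNIV. c m m s * L q $ s $ r - L m $ s $ q * L s $ m $ r)"
proof -
  have L_diag: "L m $ m $ s = c m m s" for m s
    using skew_c[of m s m] skew_c[of s m m] Koszul[of m m s] by linarith
  have "frame_ricci $ q $ r = (\<Sum>m\<in>UNIV. \<Sum>s\<in>UNIV. c m m s * L q $ s $ r)
      - (\<Sum>m\<in>UNIV. \<Sum>s\<in>UNIV. L q $ m $ s * L m $ s $ r)
      - (\<Sum>m\<in>UNIV. \<Sum>s\<in>UNIV. (L m $ s $ q - L q $ s $ m) * L s $ m $ r)"
    by (simp add: frame_ricci_def curv_coeff_def matrix_mult_nth sum_subtractf L_diag L_torsion_free)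
  also have "(\<Sum>m\<in>UNIV. \<Sum>s\<in>UNIV. L q $ m $ s * L m $ s $ r) =
      (\<Sum>m\<in>UNIV. \<Sum>s\<in>UNIV. L q $ s $ m * L s $ m $ r)"
    by (rule sum.swap)
  also have "(\<Sum>m\<in>UNIV. \<Sum>s\<in>UNIV. c m m s * L q $ s $ r)
      - (\<Sum>m\<in>UNIV. \<Sum>s\<in>UNIV. L q $ s $ m * L s $ m $ r)
      - (\<Sum>m\<in>UNIV. \<Sum>s\<in>UNIV. (L m $ s $ q - L q $ s $ m) * L s $ m $ r)
     = (\<Sum>m\<in>UNIV. \<Sum>s\<in>UNIV. c m m s * L q $ s $ r - L m $ s $ q * L s $ m $ r)"
    by (simp add: left_diff_distrib sum_subtractf)
  also have "\<dots> = (\<Sum>s\<in>UNIV. \<Sum>m\<in>UNIV. c m m s * L q $ s $ r - L m $ s $ q * L s $ m $ r)"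
    by (rule sum.swap)
  finally show ?thesis .
qed

text \<open>Before symmetrisation the two sides differ by a multiple of the sum of
  \<open>c m m s * c s q r\<close>, the trace of the adjoint action of a bracket. Symmetry of
  \<open>frame_ricci\<close> removes it.\<close>

lemma frame_ricci_eq_ricci_coord:
  assumes u: "u \<in> U"
  shows "frame_ricci $ q $ r = ricci_coord c q r"
proof -
  define P where "P q r s m = c m m s * L q $ s $ r - L m $ s $ q * L s $ m $ r" for q r s m
  define R where "R s m = - (1/2) * c s m q * c m s r + (1/4) * c q m s * c r m s
      - (1/2) * c s m q * c s m r + (1/2) * c m m s * (c r s q + c q s r)" for s m
  have "frame_ricci $ q $ r = frame_ricci $ r $ q"
    using transpose_frame_ricci[OF u] by (metis transpose_nth)
  then have "2 * frame_ricci $ q $ r = (\<Sum>s\<in>UNIV. \<Sum>m\<in>UNIV. P q r s m) + (\<Sum>s\<in>UNIV. \<Sum>m\<in>UNIV. P r q s m)"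
    by (simp add: frame_ricci_eq P_def)
  \<comment> \<open>Averaging over the exchange of \<open>q\<close> with \<open>r\<close> and of
    \<open>s\<close> with \<open>m\<close> makes the two sums agree summand by summand.\<close>
  then have "4 * frame_ricci $ q $ r = (\<Sum>s\<in>UNIV. \<Sum>m\<in>UNIV. P q r s m) + (\<Sum>m\<in>UNIV. \<Sum>s\<in>UNIV. P q r s m)
      + (\<Sum>s\<in>UNIV. \<Sum>m\<in>UNIV. P r q s m) + (\<Sum>m\<in>UNIV. \<Sum>s\<in>UNIV. P r q s m)"
    using sum.swap[of "\<lambda>s m. P q r s m" UNIV UNIV] sum.swap[of "\<lambda>s m. P r q s m" UNIV UNIV] by linarith
  also have "\<dots> = (\<Sum>s\<in>UNIV. \<Sum>m\<in>UNIV. P q r s m + P q r m s + P r q s m + P r q m s)"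
    by (simp add: sum.distrib)
  also have "\<dots> = (\<Sum>s\<in>UNIV. \<Sum>m\<in>UNIV. 2 * R s m + 2 * R m s)"
  proof (intro sum.cong refl)
    fix s m
    \<comment> \<open>Each instance rewrites one way, putting lower indices in the order m, s, q, r;
      the general law would rewrite back and forth.\<close>
    note sk = skew_c[of s q m] skew_c[of m q s] skew_c[of q s m] skew_c[of r s m] skew_c[of s r m]
      skew_c[of m r s] skew_c[of q r s] skew_c[of r q s] skew_c[of s r q]
      skew_c[of q r m] skew_c[of r q m] skew_c[of m r q]
    show "P q r s m + P q r m s + P r q s m + P r q m s = 2 * R s m + 2 * R m s"
      unfolding P_def R_def L_def
      by (simp add: sk) (simp add: field_simps)
  qed
  also have "\<dots> = 2 * (\<Sum>s\<in>UNIV. \<Sum>m\<in>UNIV. R s m) + 2 * (\<Sum>s\<in>UNIV. \<Sum>m\<in>UNIV. R m s)"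
    by (simp add: sum.distrib sum_distrib_left)
  also have "(\<Sum>s\<in>UNIV. \<Sum>m\<in>UNIV. R m s) = (\<Sum>s\<in>UNIV. \<Sum>m\<in>UNIV. R s m)"
    by (rule sum.swap)
  finally show ?thesis by (simp add: ricci_coord_def R_def)
qed

end

subsection \<open>The Ricci tensor of an orthonormal frame\<close>

lemma smooth_on_C2:
  assumes "smooth_on S f"
  shows "\<And>u. u \<in> S \<Longrightarrow> f differentiable (at u)"
    and "\<And>u v. u \<in> S \<Longrightarrow> (\<lambda>x. frechet_derivative f (at x) v) differentiable (at u)"
    and "\<And>v w. continuous_on S
      (\<lambda>x. frechet_derivative (\<lambda>y. frechet_derivative f (at y) v) (at x) w)"
proof -
  have "Ck_on (Suc (Suc 0)) S f"
    using assms unfolding smooth_on_def by blast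
  then show "\<And>u. u \<in> S \<Longrightarrow> f differentiable (at u)"
    and "\<And>u v. u \<in> S \<Longrightarrow> (\<lambda>x. frechet_derivative f (at x) v) differentiable (at u)"
    and "\<And>v w. continuous_on S
      (\<lambda>x. frechet_derivative (\<lambda>y. frechet_derivative f (at y) v) (at x) w)"
    by auto
qed

lemma inner_frame_matrix:
  fixes X :: "'n::finite \<Rightarrow> real ^ 'n" and M :: "real ^ 'n ^ 'n"
  defines "B \<equiv> \<chi> k i. X i $ k"
  shows "X i \<bullet> (M *v X j) = (transpose B ** M ** B) $ i $ j"
  unfolding transpose_mult_nth
  by (simp add: B_def inner_vec_def matrix_vector_mult_def sum_distrib_left mult.assoc)

lemma
  assumes "smooth_atlas A" "c \<in> A"
  shows open_chart: "open (snd c ` fst c)"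
    and chart_inv_coord: "\<And>p. p \<in> fst c \<Longrightarrow> chart_inv c (snd c p) = p"
proof -
  have "open (snd c ` fst c) \<and> homeomorphism (fst c) (snd c ` fst c) (snd c) (chart_inv c)"
    using assms unfolding smooth_atlas_def by blast
  then show "open (snd c ` fst c)" "\<And>p. p \<in> fst c \<Longrightarrow> chart_inv c (snd c p) = p"
    by (auto simp: homeomorphism_def)
qed

lemma lie_bracket_skew: "lie_bracket A Y X c p = - lie_bracket A X Y c p"
  by (simp add: lie_bracket_def)

lemma lie_bracket_lincomb:
  assumes A: "smooth_atlas A" and c: "c \<in> A" and p: "p \<in> fst c"
    and E: "\<And>i. smooth_field A (E i)"
  shows "lie_bracket A (lincomb a E) (lincomb b E) c p =
    (\<Sum>s\<in>UNIV. \<Sum>m\<in>UNIV. (a s * b m) *\<^sub>R lie_bracket A (E s) (E m) c p)"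
proof -
  let ?D = "\<lambda>i. frechet_derivative (\<lambda>u. E i c (chart_inv c u)) (at (snd c p))"
  have diff: "(\<lambda>u. E i c (chart_inv c u)) differentiable (at (snd c p))" for i
    using E[of i] c p smooth_on_C2(1) unfolding smooth_field_def by blast
  have lin: "linear (?D i)" for i
    by (rule linear_frechet_derivative[OF diff])
  have D: "frechet_derivative (\<lambda>u. lincomb b E c (chart_inv c u)) (at (snd c p)) =
      (\<lambda>v. \<Sum>m\<in>UNIV. b m *\<^sub>R ?D m v)" for b
    unfolding lincomb_def
    by (rule frechet_derivative_at[symmetric])
      (intro has_derivative_sum has_derivative_scaleR_right, rule has_derivative_pd[OF diff])
  have "?D m (lincomb a E c p) = (\<Sum>s\<in>UNIV. a s *\<^sub>R ?D m (E s c p))" for a m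
    by (simp add: lincomb_def linear_sum[OF lin] linear_scale[OF lin])
  then have "lie_bracket A (lincomb a E) (lincomb b E) c p =
      (\<Sum>m\<in>UNIV. \<Sum>s\<in>UNIV. (a s * b m) *\<^sub>R ?D m (E s c p)) -
      (\<Sum>s\<in>UNIV. \<Sum>m\<in>UNIV. (a s * b m) *\<^sub>R ?D s (E m c p))"
    using c p by (simp add: lie_bracket_def D scaleR_sum_right mult.commute)
  also have "(\<Sum>m\<in>UNIV. \<Sum>s\<in>UNIV. (a s * b m) *\<^sub>R ?D m (E s c p)) =
      (\<Sum>s\<in>UNIV. \<Sum>m\<in>UNIV. (a s * b m) *\<^sub>R ?D m (E s c p))"
    by (rule sum.swap)
  finally show ?thesis
    using c p by (simp add: lie_bracket_def sum_subtractf scaleR_right_diff_distrib)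
qed

text \<open>Frame and metric are read in the coordinates of one chart, where they form a
  \<open>constant_frame\<close>; what remains is to match the chart definitions of connection and
  curvature with \<open>\<Gamma>\<close> and \<open>curv\<close>.\<close>

theorem ricci_orthonormal_frame:
  fixes A :: "('a::topological_space, real ^ 'n::finite) chart set"
  assumes A: "smooth_atlas A"
    and g: "riemannian_metric A g"
    and X: "\<And>i. smooth_field A (X i)"
    and on: "orthonormal A g X"
    and br: "\<And>c p i j. \<lbrakk>c \<in> A; p \<in> fst c\<rbrakk> \<Longrightarrow>
      lie_bracket A (X i) (X j) c p = lincomb (\<lambda>k. C k i j) X c p"
    and skew: "\<And>k i j. C k i j = - C k j i"
    and c: "c \<in> A" and p: "p \<in> fst c"
  shows "X i c p \<bullet> (ricci g c p *v X j c p) = ricci_coord C i j"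
proof -
  define U where "U = snd c ` fst c"
  define f where "f i u = X i c (chart_inv c u)" for i u
  define F :: "real ^ 'n \<Rightarrow> real ^ 'n ^ 'n" where "F u = (\<chi> k i. f i u $ k)" for u
  define G where "G u = g c (chart_inv c u)" for u
  note open_U = open_chart[OF A c, folded U_def] and inv = chart_inv_coord[OF A c]
  have inv_U: "chart_inv c u \<in> fst c" "snd c (chart_inv c u) = u" if "u \<in> U" for u
    using that inv by (auto simp: U_def)
  have smooth: "smooth_on U (f i)" for i
    using X[of i] c unfolding smooth_field_def U_def f_def[abs_def] by blast
  have pd_fun: "pd a h = (\<lambda>u. frechet_derivative h (at u) (axis a 1))"
    for a and h :: "real ^ 'n \<Rightarrow> real ^ 'n"
    by (simp add: fun_eq_iff pd_def)
  have f: "f i differentiable (at u)" if "u \<in> U" for i u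
    using smooth_on_C2(1)[OF smooth that] .
  have pd_f: "pd a (f i) differentiable (at u)" if "u \<in> U" for a i u
    unfolding pd_fun using smooth_on_C2(2)[OF smooth that] .
  have pd_f_commute: "pd a (pd b (f i)) u = pd b (pd a (f i)) u" if "u \<in> U" for a b i u
    by (rule pd_pd_commute[OF open_U that f pd_f])
      (use smooth_on_C2(3)[OF smooth] in \<open>simp_all add: pd_fun\<close>)
  have bl: "bounded_linear (\<lambda>v :: real ^ 'n. v $ k)" for k
    by (rule bounded_linear_vec_nth)
  have pd_F: "pd a F u = (\<chi> k i. pd a (f i) u $ k)" if "u \<in> U" and "F differentiable (at u)" for a u
  proof -
    have "pd a F u $ k $ i = pd a (\<lambda>v. F v $ k $ i) u" for k i
      by (rule pd_bounded_linear[OF bounded_linear_entry that(2), symmetric])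
    also have "pd a (\<lambda>v. F v $ k $ i) u = pd a (f i) u $ k" for k i
      unfolding F_def vec_lambda_beta by (rule pd_bounded_linear[OF bl f[OF that(1)]])
    finally show ?thesis by (simp add: vec_eq_iff)
  qed
  have F: "F differentiable (at u)" if "u \<in> U" for u
    unfolding F_def[abs_def]
    by (intro differentiable_vec_lambda differentiable_bounded_linear[OF bl] f that)
  have G: "G differentiable (at u)" if "u \<in> U" for u
  proof -
    have "smooth_on U G"
      using g c unfolding riemannian_metric_def smooth_field_def U_def G_def[abs_def] by blast
    then show ?thesis using smooth_on_C2(1) that by blast
  qed
  interpret constant_frame U F G C
  proof
    show "open U" by (rule open_U)
    show "F differentiable (at u)" "G differentiable (at u)" if "u \<in> U" for u
      using F G that by auto
    show dpF: "pd a F differentiable (at u)" if "u \<in> U" for a u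
      by (rule differentiable_cong_open[OF open_U that, of "\<lambda>u. \<chi> k i. pd a (f i) u $ k"])
        (auto simp: pd_F F intro!: differentiable_vec_lambda differentiable_bounded_linear[OF bl] pd_f that)
    show "pd a (pd b F) u = pd b (pd a F) u" if "u \<in> U" for a b u
    proof -
      have "pd a (pd b F) u $ k $ i = pd a (pd b (f i)) u $ k" for a b k i
      proof -
        have "pd a (pd b F) u $ k $ i = pd a (\<lambda>v. pd b F v $ k $ i) u"
          by (rule pd_bounded_linear[OF bounded_linear_entry dpF[OF that], symmetric])
        also have "\<dots> = pd a (\<lambda>v. pd b (f i) v $ k) u"
          by (rule pd_cong_open[OF open_U that]) (simp add: pd_F F)
        also have "\<dots> = pd a (pd b (f i)) u $ k"
          by (rule pd_bounded_linear[OF bl pd_f[OF that]])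
        finally show ?thesis .
      qed
      then show ?thesis by (simp add: vec_eq_iff pd_f_commute[OF that, of a b])
    qed
    show "transpose (G u) = G u" if "u \<in> U" for u
      using g c inv_U[OF that] unfolding riemannian_metric_def G_def by blast
    show "transpose (F u) ** G u ** F u = mat 1" if "u \<in> U" for u
    proof -
      have "(transpose (F u) ** G u ** F u) $ i $ j = (if i = j then 1 else 0)" for i j
        using on c inv_U[OF that] unfolding orthonormal_def F_def G_def f_def
        by (simp add: inner_frame_matrix[symmetric])
      then show ?thesis by (simp add: vec_eq_iff mat_def)
    qed
    show "C k i j = - C k j i" for k i j by (rule skew)
    show "(\<Sum>a\<in>UNIV. F u $ a $ p * pd a F u $ k $ q) - (\<Sum>a\<in>UNIV. F u $ a $ q * pd a F u $ k $ p) =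
        (\<Sum>m\<in>UNIV. C m p q * F u $ k $ m)" if u: "u \<in> U" for u k p q
    proof -
      let ?P = "chart_inv c u"
      have "lie_bracket A (X p) (X q) c ?P $ k = lincomb (\<lambda>k. C k p q) X c ?P $ k"
        by (simp add: br[OF c inv_U(1)[OF u]])
      moreover have "lie_bracket A (X p) (X q) c ?P =
          frechet_derivative (f q) (at u) (f p u) - frechet_derivative (f p) (at u) (f q u)"
        using c inv_U[OF u] by (simp add: lie_bracket_def f_def[abs_def])
      ultimately show ?thesis
        by (simp add: frechet_derivative_eq_pd[OF f[OF u]] pd_F[OF u F[OF u]] F_def lincomb_def f_def)
    qed
  qed
  define u where "u = snd c p"
  have u: "u \<in> U" "chart_inv c u = p"
    using p inv by (auto simp: u_def U_def)
  have pdc: "pderiv_chart c i h (chart_inv c v) = pd i (h \<circ> chart_inv c) v" if "v \<in> U" for i h v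
    using inv_U[OF that] by (simp add: pderiv_chart_def pd_def)
  \<comment> \<open>Needed on all of \<open>U\<close>, not only at \<open>u\<close>, because the
    curvature differentiates the Christoffel symbols.\<close>
  have chr: "christoffel c g k i j (chart_inv c v) = \<Gamma> i v $ k $ j" if "v \<in> U" for k i j v
    using christoffel_eq_\<Gamma>[OF that, of k i j]
    by (simp add: christoffel_def pdc[OF that] G_def[abs_def] o_def)
  have pd_chr: "pderiv_chart c a (christoffel c g k i j) p = pd a (\<Gamma> i) u $ k $ j" for a k i j
  proof -
    have "pderiv_chart c a (christoffel c g k i j) p = pd a (christoffel c g k i j \<circ> chart_inv c) u"
      using pdc[OF u(1)] u(2) by simp
    also have "\<dots> = pd a (\<lambda>v. \<Gamma> i v $ k $ j) u"
      by (rule pd_cong_open[OF open_U u(1)]) (simp add: chr)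
    also have "\<dots> = pd a (\<Gamma> i) u $ k $ j"
      by (rule pd_bounded_linear[OF bounded_linear_entry diff_\<Gamma>[OF u(1)]])
    finally show ?thesis .
  qed
  have "riemann c g l i j k p = curv i j u $ l $ k" for l i j k
    using chr[OF u(1)] u(2)
    by (simp add: riemann_def curv_def pd_chr matrix_mult_nth sum_subtractf)
  then have "ricci g c p = ric u"
    by (simp add: ricci_def ric_def)
  moreover have "X i c p = f i u" for i
    by (simp add: f_def u(2))
  ultimately have "X i c p \<bullet> (ricci g c p *v X j c p) = (transpose (F u) ** ric u ** F u) $ i $ j"
    by (simp add: inner_frame_matrix[of "\<lambda>i. f i u"] F_def)
  then show ?thesis
    by (simp add: ric_frame[OF u(1)] frame_ricci_eq_ricci_coord[OF u(1)])
qed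

subsection \<open>The flow in a moving frame\<close>

lemma structure_constants_skew:
  assumes "\<And>k i j. C k i j = - C k j i"
  shows "structure_constants Q C k i j = - structure_constants Q C k j i"
proof -
  have "structure_constants Q C k i j =
      (\<Sum>m\<in>UNIV. \<Sum>s\<in>UNIV. \<Sum>l\<in>UNIV. Q $ s $ i * Q $ m $ j * C l s m * matrix_inv Q $ k $ l)"
    unfolding structure_constants_def by (rule sum.swap)
  also have "\<dots> = (\<Sum>m\<in>UNIV. \<Sum>s\<in>UNIV. \<Sum>l\<in>UNIV. - (Q $ m $ j * Q $ s $ i * C l m s * matrix_inv Q $ k $ l))"
  proof (intro sum.cong refl)
    fix m s l
    show "Q $ s $ i * Q $ m $ j * C l s m * matrix_inv Q $ k $ l =
        - (Q $ m $ j * Q $ s $ i * C l m s * matrix_inv Q $ k $ l)"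
      unfolding assms[of l s m] by simp
  qed
  finally show ?thesis
    by (simp add: structure_constants_def sum_negf)
qed

lemma lie_bracket_change_frame:
  assumes A: "smooth_atlas A" and c: "c \<in> A" and p: "p \<in> fst c"
    and E: "\<And>i. smooth_field A (E i)"
    and br: "\<And>i j. lie_bracket A (E i) (E j) = lincomb (\<lambda>k. C k i j) E"
    and X: "\<And>i. X i = lincomb (\<lambda>j. Q $ j $ i) E"
    and Q: "Q ** matrix_inv Q = mat 1"
  shows "lie_bracket A (X i) (X j) c p = lincomb (\<lambda>k. structure_constants Q C k i j) X c p"
proof -
  let ?R = "matrix_inv Q"
  \<comment> \<open>The bilinear expansion yields brackets in the fixed frame; inverting
    \<open>Q\<close> turns them back into the new frame.\<close>
  have E_X: "E l c p = (\<Sum>k\<in>UNIV. ?R $ k $ l *\<^sub>R X k c p)" for l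
  proof -
    have "(\<Sum>k\<in>UNIV. ?R $ k $ l *\<^sub>R X k c p) = (\<Sum>k\<in>UNIV. \<Sum>j\<in>UNIV. (Q $ j $ k * ?R $ k $ l) *\<^sub>R E j c p)"
      by (simp add: X lincomb_def scaleR_sum_right mult.commute)
    also have "\<dots> = (\<Sum>j\<in>UNIV. \<Sum>k\<in>UNIV. (Q $ j $ k * ?R $ k $ l) *\<^sub>R E j c p)"
      by (rule sum.swap)
    also have "\<dots> = (\<Sum>j\<in>UNIV. (Q ** ?R) $ j $ l *\<^sub>R E j c p)"
      by (simp add: matrix_mult_nth scaleR_sum_left)
    also have "\<dots> = E l c p"
      by (simp add: Q mat_def if_distrib[of "\<lambda>x. x *\<^sub>R _"] cong: if_cong)
    finally show ?thesis by simp
  qed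
  have "lie_bracket A (X i) (X j) c p = (\<Sum>s\<in>UNIV. \<Sum>m\<in>UNIV. \<Sum>l\<in>UNIV. \<Sum>k\<in>UNIV.
      (Q $ s $ i * Q $ m $ j * C l s m * ?R $ k $ l) *\<^sub>R X k c p)"
    unfolding X[of i] X[of j] lie_bracket_lincomb[OF A c p E] br
    by (simp only: lincomb_def E_X scaleR_sum_right scaleR_scaleR mult.assoc)
  also have "\<dots> = (\<Sum>s\<in>UNIV. \<Sum>m\<in>UNIV. \<Sum>k\<in>UNIV. \<Sum>l\<in>UNIV.
      (Q $ s $ i * Q $ m $ j * C l s m * ?R $ k $ l) *\<^sub>R X k c p)"
    by (rule sum.cong[OF refl], rule sum.cong[OF refl], rule sum.swap)
  also have "\<dots> = (\<Sum>s\<in>UNIV. \<Sum>k\<in>UNIV. \<Sum>m\<in>UNIV. \<Sum>l\<in>UNIV.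
      (Q $ s $ i * Q $ m $ j * C l s m * ?R $ k $ l) *\<^sub>R X k c p)"
    by (rule sum.cong[OF refl], rule sum.swap)
  also have "\<dots> = (\<Sum>k\<in>UNIV. \<Sum>s\<in>UNIV. \<Sum>m\<in>UNIV. \<Sum>l\<in>UNIV.
      (Q $ s $ i * Q $ m $ j * C l s m * ?R $ k $ l) *\<^sub>R X k c p)"
    by (rule sum.swap)
  finally show ?thesis
    by (simp add: lincomb_def structure_constants_def scaleR_sum_left)
qed

text \<open>Only \<open>Q\<close> and \<open>G\<close> vary in time, so differentiating
  orthonormality expresses the derivative of \<open>G\<close> in the moving frame through
  \<open>matrix_inv (Q t) ** Q'\<close>. Congruence by \<open>B t\<close> loses no information,
  which gives the equivalence.\<close>

lemma flow_equation_in_frame: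
  fixes B G :: "real \<Rightarrow> real ^ 'n ^ 'n" and F0 Q' R :: "real ^ 'n ^ 'n"
  assumes I: "open I" "t \<in> I"
    and B: "\<And>s. s \<in> I \<Longrightarrow> B s = F0 ** Q s"
    and on: "\<And>s. s \<in> I \<Longrightarrow> transpose (B s) ** G s ** B s = mat 1"
    and sym: "transpose (G t) = G t"
    and G': "(G has_vector_derivative G') (at t)"
    and Q': "(Q has_vector_derivative Q') (at t)"
  shows "G' = (-2) *\<^sub>R R \<longleftrightarrow>
    matrix_inv (Q t) ** Q' + transpose (matrix_inv (Q t) ** Q') =
    2 *\<^sub>R (transpose (B t) ** R ** B t)"
proof -
  note mult = bounded_bilinear.has_vector_derivative[OF bounded_bilinear_matrix_mult]
  let ?M = "matrix_inv (Q t) ** Q'"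
  \<comment> \<open>Orthonormality itself exhibits a left inverse of \<open>Q t\<close>.\<close>
  have inv: "matrix_inv (Q t) = transpose (B t) ** G t ** F0"
    using on[OF I(2)] by (intro matrix_inv_eqI) (simp add: B[OF I(2)] matrix_mul_assoc)
  have B': "((\<lambda>s. F0 ** Q s) has_vector_derivative F0 ** Q') (at t)"
    by (rule bounded_linear.has_vector_derivative[OF
          bounded_bilinear.bounded_linear_right[OF bounded_bilinear_matrix_mult] Q'])
  have "((\<lambda>s. transpose (F0 ** Q s) ** G s ** (F0 ** Q s)) has_vector_derivative
      transpose (F0 ** Q t) ** G t ** (F0 ** Q') +
      (transpose (F0 ** Q t) ** G' + transpose (F0 ** Q') ** G t) ** (F0 ** Q t)) (at t)"
    by (intro mult B' G' bounded_linear.has_vector_derivative[OF bounded_linear_transpose])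
  moreover have "((\<lambda>s. transpose (F0 ** Q s) ** G s ** (F0 ** Q s)) has_vector_derivative 0) (at t)"
    by (rule has_vector_derivative_transform_within_open[OF has_vector_derivative_const I])
      (use on B in simp)
  ultimately have "transpose (B t) ** G t ** (F0 ** Q') +
      (transpose (B t) ** G' + transpose (F0 ** Q') ** G t) ** B t = 0"
    unfolding B[OF I(2)] by (rule vector_derivative_unique_at)
  moreover have "transpose (B t) ** G t ** (F0 ** Q') = ?M"
    by (simp add: inv matrix_mul_assoc)
  moreover have "transpose (F0 ** Q') ** G t ** B t = transpose ?M"
    by (simp add: inv matrix_transpose_mul sym matrix_mul_assoc)
  ultimately have "?M + (transpose (B t) ** G' ** B t + transpose ?M) = 0"
    by (simp add: matrix_distribs)
  then have key: "transpose (B t) ** G' ** B t = - (?M + transpose ?M)"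
    by (simp only: eq_neg_iff_add_eq_0 add_ac)
  have "B t ** (transpose (B t) ** G t) = mat 1"
    using on[OF I(2)] matrix_left_right_inverse by blast
  then have "G' = (-2) *\<^sub>R R \<longleftrightarrow>
      transpose (B t) ** G' ** B t = transpose (B t) ** ((-2) *\<^sub>R R) ** B t"
    using matrix_congruence_cancel by blast
  also have "\<dots> \<longleftrightarrow> - (?M + transpose ?M) = - (2 *\<^sub>R (transpose (B t) ** R ** B t))"
    unfolding key by (simp add: matrix_distribs)
  finally show ?thesis by (simp only: neg_equal_iff_equal)
qed

lemma smooth_family_differentiable:
  fixes T :: "real \<Rightarrow> ('a, real ^ 'n::finite) chart \<Rightarrow> 'a \<Rightarrow> 'v::real_normed_vector"
  assumes "smooth_family A I T" "c \<in> A" "t \<in> I" "p \<in> fst c" "chart_inv c (snd c p) = p"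
  shows "(\<lambda>s. T s c p) differentiable (at t)"
proof -
  have "(\<lambda>(t, u). T t c (chart_inv c u)) differentiable (at (t, snd c p))"
    using assms smooth_on_C2(1) unfolding smooth_family_def by blast
  moreover have "(\<lambda>s. (s, snd c p)) differentiable (at t)"
    by (auto intro!: derivative_eq_intros differentiableI)
  ultimately have "(\<lambda>(t, u). T t c (chart_inv c u)) \<circ> (\<lambda>s. (s, snd c p)) differentiable (at t)"
    by (intro differentiable_chain_at) auto
  then show ?thesis by (simp add: o_def assms(5))
qed

theorem proposition3:
  fixes A :: "('a::{t2_space, second_countable_topology}, real ^ 'n) chart set"
    and mul :: "'a \<Rightarrow> 'a \<Rightarrow> 'a" and e :: 'a and inversion :: "'a \<Rightarrow> 'a"
    and I :: "real set"
    and g :: "real \<Rightarrow> ('a, 'n::finite) tensor2"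
    and E :: "'n \<Rightarrow> ('a, 'n) vfield"
    and Et :: "real \<Rightarrow> 'n \<Rightarrow> ('a, 'n) vfield"
    and Q :: "real \<Rightarrow> real ^ 'n ^ 'n"
    and C :: "'n \<Rightarrow> 'n \<Rightarrow> 'n \<Rightarrow> real"
  assumes "lie_group A mul e inversion"
    and "open I" and "is_interval I" and "0 \<in> I"
    and "\<And>t. t \<in> I \<Longrightarrow> left_invariant_metric A mul (g t)"
    and "smooth_family A I g"
    and "frame A mul E" and "orthonormal A (g 0) E"
    and "\<And>i j. lie_bracket A (E i) (E j) = lincomb (\<lambda>k. C k i j) E"
    and "\<And>t. t \<in> I \<Longrightarrow> frame A mul (Et t)"
    and "\<And>i. smooth_family A I (\<lambda>t. Et t i)"
    and "\<And>t. t \<in> I \<Longrightarrow> orthonormal A (g t) (Et t)"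
    and "\<And>i. Et 0 i = E i"
    and "\<And>t i. t \<in> I \<Longrightarrow> Et t i = lincomb (\<lambda>j. Q t $ j $ i) E"
  shows "(\<forall>t\<in>I. \<forall>c\<in>A. \<forall>p\<in>fst c. \<forall>i j.
            Et t i c p \<bullet> (ricci (g t) c p *v Et t j c p) =
            ricci_coord (structure_constants (Q t) C) i j) \<and>
         (ricci_flow A I g \<longleftrightarrow>
          (\<forall>t\<in>I. \<forall>i j.
            (\<Sum>s\<in>UNIV. matrix_inv (Q t) $ j $ s * vector_derivative Q (at t) $ s $ i) +
            (\<Sum>s\<in>UNIV. matrix_inv (Q t) $ i $ s * vector_derivative Q (at t) $ s $ j) =
            2 * ricci_coord (structure_constants (Q t) C) i j))"
proof -
  have A: "smooth_atlas A"
    using assms(1) by (simp add: lie_group_def)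
  have metric: "riemannian_metric A (g t)" if "t \<in> I" for t
    using assms(5)[OF that] by (simp add: left_invariant_metric_def)
  have smooth_frame: "smooth_field A (X i)" if "frame A mul X" for X :: "'n \<Rightarrow> ('a, 'n) vfield" and i
    using that by (simp add: frame_def lie_algebra_def vector_field_def)
  \<comment> \<open>Antisymmetry of the bracket passes to the coefficients by linear independence of
    the frame.\<close>
  have skew: "C k i j = - C k j i" for k i j
  proof -
    have "lincomb (\<lambda>k. C k i j + C k j i) E c p = 0" for c p
    proof -
      have "lincomb (\<lambda>k. C k i j + C k j i) E c p =
          lie_bracket A (E i) (E j) c p + lie_bracket A (E j) (E i) c p"
        by (simp add: assms(9) lincomb_def scaleR_left_distrib sum.distrib)
      then show ?thesis by (simp add: lie_bracket_skew[of A "E j"])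
    qed
    then have "lincomb (\<lambda>k. C k i j + C k j i) E = (\<lambda>c p. 0)"
      by (simp add: fun_eq_iff)
    then have "C k i j + C k j i = 0"
      using assms(7) unfolding frame_def by blast
    then show ?thesis by simp
  qed
  define B where "B c p t = (\<chi> k i. Et t i c p $ k)" for c p t
  have on: "transpose (B c p t) ** g t c p ** B c p t = mat 1"
    if "t \<in> I" "c \<in> A" "p \<in> fst c" for t c p
    using assms(12)[OF that(1)] that(2,3) unfolding orthonormal_def
    by (simp add: vec_eq_iff mat_def B_def inner_frame_matrix[symmetric])
  have B_Q: "B c p t = (\<chi> k j. E j c p $ k) ** Q t" if "t \<in> I" for t c p
    by (simp add: vec_eq_iff matrix_mult_nth B_def assms(14)[OF that] lincomb_def mult.commute)
  \<comment> \<open>\<open>Q\<close> does not depend on the point, so its invertibility and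
    differentiability can be read off at a single one.\<close>
  obtain c0 p0 where c0: "c0 \<in> A" "p0 \<in> fst c0"
    using A unfolding smooth_atlas_def by blast
  have Q_inv: "Q t ** matrix_inv (Q t) = mat 1" if "t \<in> I" for t
  proof -
    define R where "R = transpose (B c0 p0 t) ** g t c0 p0 ** (\<chi> k j. E j c0 p0 $ k)"
    have "R ** Q t = mat 1"
      using on[OF that c0] by (simp add: R_def B_Q[OF that] matrix_mul_assoc)
    then show ?thesis
      using matrix_inv_eqI matrix_left_right_inverse by metis
  qed
  have ricci: "Et t i c p \<bullet> (ricci (g t) c p *v Et t j c p) =
      ricci_coord (structure_constants (Q t) C) i j"
    if "t \<in> I" "c \<in> A" "p \<in> fst c" for t c p i j
    by (rule ricci_orthonormal_frame[OF A metric smooth_frame _ _ structure_constants_skew[OF skew]])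
      (use that assms(10,12) lie_bracket_change_frame[OF A _ _ smooth_frame[OF assms(7)] assms(9)
          assms(14) Q_inv] in auto)
  have Q': "(Q has_vector_derivative vector_derivative Q (at t)) (at t)" if t: "t \<in> I" for t
  proof -
    \<comment> \<open>The inverse of the frame matrix of \<open>E\<close> at \<open>p0\<close>,
      constant in time; multiplying by it recovers \<open>Q\<close> from the moving frame.\<close>
    define R where "R = transpose (B c0 p0 0) ** g 0 c0 p0"
    have inv: "chart_inv c0 (snd c0 p0) = p0"
      by (rule chart_inv_coord[OF A c0])
    have R: "R ** B c0 p0 s = Q s" if "s \<in> I" for s
      using on[OF assms(4) c0] assms(13)
      by (simp add: B_Q[OF that] matrix_mul_assoc) (simp add: R_def B_def)
    have "(\<lambda>s. Et s i c0 p0 $ k) differentiable (at t)" for i k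
      by (rule differentiable_bounded_linear[OF bounded_linear_vec_nth
            smooth_family_differentiable[OF assms(11) c0(1) t c0(2) inv]])
    then have "B c0 p0 differentiable (at t)"
      unfolding B_def[abs_def] by (intro differentiable_vec_lambda)
    then have "(\<lambda>s. R ** B c0 p0 s) differentiable (at t)"
      by (intro differentiable_matrix_mult differentiable_const)
    then have "Q differentiable (at t)"
      using differentiable_cong_open[OF assms(2) t, of "\<lambda>s. R ** B c0 p0 s" Q] R by blast
    then show ?thesis by (simp add: vector_derivative_works)
  qed
  let ?M = "\<lambda>t. matrix_inv (Q t) ** vector_derivative Q (at t)"
  have flow: "((\<lambda>s. g s c p) has_vector_derivative (-2) *\<^sub>R ricci (g t) c p) (at t) \<longleftrightarrow>
      (\<forall>i j. ?M t $ j $ i + ?M t $ i $ j = 2 * ricci_coord (structure_constants (Q t) C) i j)"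
    if t: "t \<in> I" and c: "c \<in> A" and p: "p \<in> fst c" for t c p
  proof -
    let ?g = "\<lambda>s. g s c p"
    have "?g differentiable (at t)"
      by (rule smooth_family_differentiable[OF assms(6) c t p chart_inv_coord[OF A c p]])
    then have g': "(?g has_vector_derivative vector_derivative ?g (at t)) (at t)"
      by (simp add: vector_derivative_works)
    have sym: "transpose (g t c p) = g t c p"
      using metric[OF t] c p unfolding riemannian_metric_def by blast
    have "(?g has_vector_derivative (-2) *\<^sub>R ricci (g t) c p) (at t) \<longleftrightarrow>
        vector_derivative ?g (at t) = (-2) *\<^sub>R ricci (g t) c p"
      using g' vector_derivative_at by metis
    also have "\<dots> \<longleftrightarrow> ?M t + transpose (?M t) =
        2 *\<^sub>R (transpose (B c p t) ** ricci (g t) c p ** B c p t)"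
      by (rule flow_equation_in_frame[OF assms(2) t B_Q on[OF _ c p] sym g' Q'[OF t]])
    also have "transpose (B c p t) ** ricci (g t) c p ** B c p t =
        (\<chi> i j. ricci_coord (structure_constants (Q t) C) i j)"
      using ricci[OF t c p] by (simp add: vec_eq_iff B_def inner_frame_matrix[symmetric])
    finally show ?thesis
      by (auto simp: vec_eq_iff transpose_nth add.commute)
  qed
  show ?thesis
  proof (intro conjI)
    \<comment> \<open>The right side of \<open>flow\<close> is independent of chart and point: the
      flow equation at \<open>p0\<close> alone yields the equation for \<open>Q\<close>, which in
      turn gives the flow equation everywhere.\<close>
    show "ricci_flow A I g \<longleftrightarrow> (\<forall>t\<in>I. \<forall>i j.
        (\<Sum>s\<in>UNIV. matrix_inv (Q t) $ j $ s * vector_derivative Q (at t) $ s $ i) +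
        (\<Sum>s\<in>UNIV. matrix_inv (Q t) $ i $ s * vector_derivative Q (at t) $ s $ j) =
        2 * ricci_coord (structure_constants (Q t) C) i j)"
      unfolding ricci_flow_def matrix_mult_nth[symmetric] using flow c0 by blast
  qed (use ricci in blast)
qed

end
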